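(* Let $(E,\overline\nabla)$ be a holomorphic bundle on $T_{\theta,\tau}$ and $(E^\vee,\overline\nabla^\vee)$ its dual left holomorphic bundle. For $i=0,1$ the pairing $$H^{1-i}(E)\otimes H^i(E^\vee)\to\mathbb C,\qquad [e]\otimes[f]\mapsto\operatorname{tr}(f(e)),$$ (equivalently, the pairing into $H^1(A_\theta)=A_\theta/\delta(A_\theta)\cong\mathbb C$ induced by $e\otimes f\mapsto f(e)$) is well defined and perfect.
   Context: Fix $\theta\in\mathbb R\setminus\mathbb Q$, $\tau\in\mathbb C\setminus\mathbb R$. $A_\theta$ is the algebra of series $\sum a_{m,n}U_1^mU_2^n$ with rapidly decreasing coefficients and $U_1U_2=e^{2\pi i\theta}U_2U_1$, $\delta(\sum a_{m,n}U_1^mU_2^n)=2\pi i\sum(m\tau+n)a_{m,n}U_1^mU_2^n$, and $\operatorname{tr}(\sum a_{m,n}U_1^mU_2^n)=a_{0,0}$ (this identifies $A_\theta/\delta(A_\theta)$ with $\mathbb C$). A (right) holomorphic bundle is a pair $(E,\overline\nabla)$ with $E$ a finitely generated projective right $A_\theta$-module and $\overline\nabla:E\to E$ $\mathbb C$-linear with $\overline\nabla(ea)=\overline\nabla(e)a+e\delta(a)$. Its dual is the finitely generated projective left $A_\theta$-module $E^\vee=\operatorname{Hom}_{A_\theta}(E,A_\theta)$ (with $(af)(e)=af(e)$) equipped with $\overline\nabla^\vee(f)=\delta\circ f-f\circ\overline\nabla$, which satisfies $\overline\nabla^\vee(af)=\delta(a)f+a\overline\nabla^\vee(f)$. For a right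 or left holomorphic bundle, $H^0=\ker\overline\nabla$ and $H^1=\operatorname{coker}\overline\nabla$. *)

theory Defs
  imports "HOL-Analysis.Analysis"
begin

text \<open>Elements of A_theta are coefficient families a(m,n), standing for
  sum a(m,n) U1^m U2^n, with rapidly decreasing coefficients.\<close>

type_synonym coeffs = "int \<times> int \<Rightarrow> complex"

definition rapid :: "coeffs \<Rightarrow> bool" where
  "rapid a \<longleftrightarrow> (\<forall>k::nat. \<exists>C::real. \<forall>m n.
      norm (a (m, n)) * (1 + real_of_int (\<bar>m\<bar> + \<bar>n\<bar>)) ^ k \<le> C)"

definition Ath :: "coeffs set" where
  "Ath = {a. rapid a}"

definition addA :: "coeffs \<Rightarrow> coeffs \<Rightarrow> coeffs" where
  "addA a b = (\<lambda>x. a x + b x)"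

definition zeroA :: coeffs where
  "zeroA = (\<lambda>_. 0)"

definition cstA :: "complex \<Rightarrow> coeffs" where
  "cstA c = (\<lambda>x. if x = (0, 0) then c else 0)"

text \<open>Product from U1 U2 = e^(2 pi i theta) U2 U1, i.e.
  U2^q U1^r = e^(-2 pi i theta q r) U1^r U2^q.\<close>
definition mulA :: "real \<Rightarrow> coeffs \<Rightarrow> coeffs \<Rightarrow> coeffs" where
  "mulA \<theta> a b = (\<lambda>(m, n). \<Sum>\<^sub>\<infinity>(p, q)\<in>UNIV.
      a (p, q) * b (m - p, n - q) *
      exp (- 2 * of_real pi * \<i> * of_real \<theta> * of_int q * of_int (m - p)))"

definition deltaA :: "complex \<Rightarrow> coeffs \<Rightarrow> coeffs" where
  "deltaA \<tau> a = (\<lambda>(m, n). 2 * of_real pi * \<i> * (of_int m * \<tau> + of_int n) * a (m, n))"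

definition trA :: "coeffs \<Rightarrow> complex" where
  "trA a = a (0, 0)"

definition right_module :: "real \<Rightarrow> ('e::ab_group_add \<Rightarrow> coeffs \<Rightarrow> 'e) \<Rightarrow> bool" where
  "right_module \<theta> act \<longleftrightarrow>
     (\<forall>x y. \<forall>a\<in>Ath. act (x + y) a = act x a + act y a) \<and>
     (\<forall>x. \<forall>a\<in>Ath. \<forall>b\<in>Ath. act x (addA a b) = act x a + act x b) \<and>
     (\<forall>x. \<forall>a\<in>Ath. \<forall>b\<in>Ath. act x (mulA \<theta> a b) = act (act x a) b) \<and>
     (\<forall>x. act x (cstA 1) = x)"

definition freeA :: "nat \<Rightarrow> (nat \<Rightarrow> coeffs) set" where
  "freeA n = {v. (\<forall>i. v i \<in> Ath) \<and> (\<forall>i\<ge>n. v i = zeroA)}"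

definition fg_projective :: "real \<Rightarrow> ('e::ab_group_add \<Rightarrow> coeffs \<Rightarrow> 'e) \<Rightarrow> bool" where
  "fg_projective \<theta> act \<longleftrightarrow>
     (\<exists>(n::nat) (\<iota>::'e \<Rightarrow> nat \<Rightarrow> coeffs) (\<pi>::(nat \<Rightarrow> coeffs) \<Rightarrow> 'e).
        (\<forall>x. \<iota> x \<in> freeA n) \<and>
        (\<forall>x y. \<iota> (x + y) = (\<lambda>i. addA (\<iota> x i) (\<iota> y i))) \<and>
        (\<forall>x. \<forall>a\<in>Ath. \<iota> (act x a) = (\<lambda>i. mulA \<theta> (\<iota> x i) a)) \<and>
        (\<forall>v\<in>freeA n. \<forall>w\<in>freeA n. \<pi> (\<lambda>i. addA (v i) (w i)) = \<pi> v + \<pi> w) \<and>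
        (\<forall>v\<in>freeA n. \<forall>a\<in>Ath. \<pi> (\<lambda>i. mulA \<theta> (v i) a) = act (\<pi> v) a) \<and>
        (\<forall>x. \<pi> (\<iota> x) = x))"

definition hol_bundle ::
  "real \<Rightarrow> complex \<Rightarrow> ('e::ab_group_add \<Rightarrow> coeffs \<Rightarrow> 'e) \<Rightarrow> ('e \<Rightarrow> 'e) \<Rightarrow> bool" where
  "hol_bundle \<theta> \<tau> act nabla \<longleftrightarrow>
     right_module \<theta> act \<and> fg_projective \<theta> act \<and>
     (\<forall>x y. nabla (x + y) = nabla x + nabla y) \<and>
     (\<forall>x c. nabla (act x (cstA c)) = act (nabla x) (cstA c)) \<and>
     (\<forall>e. \<forall>a\<in>Ath. nabla (act e a) = act (nabla e) a + act e (deltaA \<tau> a))"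

definition dual :: "real \<Rightarrow> ('e::ab_group_add \<Rightarrow> coeffs \<Rightarrow> 'e) \<Rightarrow> ('e \<Rightarrow> coeffs) set" where
  "dual \<theta> act = {f. (\<forall>e. f e \<in> Ath) \<and> (\<forall>x y. f (x + y) = addA (f x) (f y)) \<and>
                    (\<forall>x. \<forall>a\<in>Ath. f (act x a) = mulA \<theta> (f x) a)}"

definition lact :: "real \<Rightarrow> coeffs \<Rightarrow> ('e \<Rightarrow> coeffs) \<Rightarrow> ('e \<Rightarrow> coeffs)" where
  "lact \<theta> a f = (\<lambda>e. mulA \<theta> a (f e))"

definition add_dual :: "('e \<Rightarrow> coeffs) \<Rightarrow> ('e \<Rightarrow> coeffs) \<Rightarrow> ('e \<Rightarrow> coeffs)" where
  "add_dual f g = (\<lambda>e. addA (f e) (g e))"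

definition zero_dual :: "'e \<Rightarrow> coeffs" where
  "zero_dual = (\<lambda>_. zeroA)"

definition nabla_dual :: "complex \<Rightarrow> ('e \<Rightarrow> 'e) \<Rightarrow> ('e \<Rightarrow> coeffs) \<Rightarrow> ('e \<Rightarrow> coeffs)" where
  "nabla_dual \<tau> nabla f = (\<lambda>e. (\<lambda>x. deltaA \<tau> (f e) x - f (nabla e) x))"

text \<open>phi is a C-linear functional on the quotient V / V0 (V a C-vector space with
  the given addition and scalar multiplication, V0 a subspace).\<close>
definition lin_functional_mod ::
  "'v set \<Rightarrow> 'v set \<Rightarrow> ('v \<Rightarrow> 'v \<Rightarrow> 'v) \<Rightarrow> (complex \<Rightarrow> 'v \<Rightarrow> 'v) \<Rightarrow> ('v \<Rightarrow> complex) \<Rightarrow> bool" where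
  "lin_functional_mod V V0 add smul \<phi> \<longleftrightarrow>
     (\<forall>x\<in>V. \<forall>y\<in>V. \<phi> (add x y) = \<phi> x + \<phi> y) \<and>
     (\<forall>c. \<forall>x\<in>V. \<phi> (smul c x) = c * \<phi> x) \<and>
     (\<forall>x\<in>V0. \<phi> x = 0)"

text \<open>The bilinear map b : V x W -> C induces a well-defined pairing
  (V/V0) x (W/W0) -> C, and this pairing is perfect: the induced maps
  V/V0 -> (W/W0)^* and W/W0 -> (V/V0)^* (algebraic duals) are bijective.\<close>
definition perfect_pairing ::
  "'v set \<Rightarrow> 'v set \<Rightarrow> ('v \<Rightarrow> 'v \<Rightarrow> 'v) \<Rightarrow> (complex \<Rightarrow> 'v \<Rightarrow> 'v) \<Rightarrow>
   'w set \<Rightarrow> 'w set \<Rightarrow> ('w \<Rightarrow> 'w \<Rightarrow> 'w) \<Rightarrow> (complex \<Rightarrow> 'w \<Rightarrow> 'w) \<Rightarrow>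
   ('v \<Rightarrow> 'w \<Rightarrow> complex) \<Rightarrow> bool" where
  "perfect_pairing V V0 addV smulV W W0 addW smulW b \<longleftrightarrow>
     (\<forall>v\<in>V0. \<forall>w\<in>W. b v w = 0) \<and>
     (\<forall>v\<in>V. \<forall>w\<in>W0. b v w = 0) \<and>
     (\<forall>v\<in>V. (\<forall>w\<in>W. b v w = 0) \<longrightarrow> v \<in> V0) \<and>
     (\<forall>w\<in>W. (\<forall>v\<in>V. b v w = 0) \<longrightarrow> w \<in> W0) \<and>
     (\<forall>\<phi>. lin_functional_mod W W0 addW smulW \<phi> \<longrightarrow> (\<exists>v\<in>V. \<forall>w\<in>W. \<phi> w = b v w)) \<and>
     (\<forall>\<psi>. lin_functional_mod V V0 addV smulV \<psi> \<longrightarrow> (\<exists>w\<in>W. \<forall>v\<in>V. \<psi> v = b v w))"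

definition H0 :: "('e::ab_group_add \<Rightarrow> 'e) \<Rightarrow> 'e set" where
  "H0 nabla = {e. nabla e = 0}"

definition H0_dual :: "real \<Rightarrow> complex \<Rightarrow> ('e::ab_group_add \<Rightarrow> coeffs \<Rightarrow> 'e) \<Rightarrow> ('e \<Rightarrow> 'e) \<Rightarrow> ('e \<Rightarrow> coeffs) set" where
  "H0_dual \<theta> \<tau> act nabla = {f \<in> dual \<theta> act. nabla_dual \<tau> nabla f = zero_dual}"

definition pairing :: "'e \<Rightarrow> ('e \<Rightarrow> coeffs) \<Rightarrow> complex" where
  "pairing e f = trA (f e)"

end

theory Submission
  imports Defs "HOL-Library.Function_Algebras"
begin

text \<open>Write \<open>E\<close> as a direct summand of \<open>A^n\<close> and extend \<open>nabla\<close> to a connection \<open>D\<close> on \<open>A^n\<close>. On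
  coefficient families \<open>D\<close> is the diagonal operator \<open>\<delta>\<close>, which grows linearly because \<open>\<tau>\<close> is not real,
  plus an operator with rapidly decreasing kernel. After enlarging finitely many diagonal entries, \<open>D\<close>
  and its transpose become invertible: a Neumann series gives bounded solutions, and these are
  automatically rapidly decreasing. It follows that every linear functional (no continuity needed)
  on rapidly decreasing families that vanishes on the image of \<open>D\<close> is the pairing with a rapidly
  decreasing family, and that every linear functional agrees with such a pairing on the kernel of
  \<open>D\<close>. Projecting to \<open>E\<close>, respectively using the transpose for the dual bundle, and extending or
  separating functionals by Hamel bases gives both perfect pairings.\<close>

section \<open>Linear functionals on arbitrary vector spaces\<close>

text \<open>Perfectness refers to algebraic duals and the bundle carries no topology, so
  representing functionals cannot rest on continuity. Finite rank replaces it. Let \<open>t\<close>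
  be the finitely supported change of diagonal that makes \<open>D + t\<close> invertible. If \<phi>
  kills the image of \<open>D\<close> and \<open>g = (D + t) v\<close>, then
  \<open>\<phi> g = \<phi> (t v)\<close> involves only finitely many coordinates of
  \<open>v\<close>, and solving the transposed equation once expresses these through
  \<open>g\<close>. On the kernel of \<open>D\<close> one has \<open>(D + t) v = t v\<close>, so
  finitely many coordinates of \<open>v\<close> again decide. The free module supplies the
  coordinates in which the leading part is diagonal; a direct summand has none. \<open>D\<close>
  preserves both summands, so that kernel and cokernel statements pass to the bundle. The pairing of
  families is bilinear and the trace of a derivative is zero, hence the transpose of
  \<open>D\<close> induces the dual connection up to sign, and the same statements about elliptic
  operators serve the bundle and its dual.\<close>

lemma linear_functional_extend:
  fixes scale :: "'a::field \<Rightarrow> 'b::ab_group_add \<Rightarrow> 'b" and \<phi> :: "'b \<Rightarrow> 'a"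
  assumes vs: "vector_space scale" and W: "module.subspace scale W"
    and add: "\<And>x y. x \<in> W \<Longrightarrow> y \<in> W \<Longrightarrow> \<phi> (x + y) = \<phi> x + \<phi> y"
    and scl: "\<And>c x. x \<in> W \<Longrightarrow> \<phi> (scale c x) = c * \<phi> x"
  shows "\<exists>\<psi>. (\<forall>x y. \<psi> (x + y) = \<psi> x + \<psi> y) \<and> (\<forall>c x. \<psi> (scale c x) = c * \<psi> x)
    \<and> (\<forall>x\<in>W. \<psi> x = \<phi> x)"
proof -
  interpret v1: vector_space scale by (rule vs)
  interpret vector_space_pair scale "(*) :: 'a \<Rightarrow> 'a \<Rightarrow> 'a"
    by (intro vector_space_pair.intro vs vector_space_over_itself.vector_space_axioms)
  obtain B where B: "B \<subseteq> W" "v1.independent B" "W \<subseteq> v1.span B"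
    using v1.maximal_independent_subset[of W] by metis
  obtain \<psi> where \<psi>: "Vector_Spaces.linear scale (*) \<psi>" "\<And>x. x \<in> B \<Longrightarrow> \<psi> x = \<phi> x"
    using linear_independent_extend[OF B(2), of \<phi>] by auto
  interpret l: Vector_Spaces.linear scale "(*)" \<psi> by (rule \<psi>(1))
  \<comment> \<open>\<phi> is linear on \<open>W\<close> only, so membership in \<open>W\<close> has
    to be carried through the induction.\<close>
  have "x \<in> W \<and> \<psi> x = \<phi> x" if "x \<in> v1.span B" for x
    using that
  proof (induction rule: v1.span_induct_alt)
    case base
    show ?case using scl[of 0 0] v1.subspace_0[OF W] l.zero by simp
  next
    case (step c x y)
    then have "x \<in> W" using B by auto
    then show ?case
      using step B W \<psi>(2) by (auto simp: l.add l.scale add scl v1.subspace_add v1.subspace_scale)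
  qed
  then show ?thesis
    using B(3) l.add l.scale by (intro exI[of _ \<psi>]) auto
qed

text \<open>A basis of \<open>W\<close> stays independent when \<open>g\<close> is added, so a
  functional may take the value 1 at \<open>g\<close> and 0 on \<open>W\<close>. With
  \<open>W\<close> the image of a connection this turns the vanishing of all pairings into
  exactness.\<close>

lemma linear_functional_separate:
  fixes scale :: "'a::field \<Rightarrow> 'b::ab_group_add \<Rightarrow> 'b"
  assumes vs: "vector_space scale" and W: "module.subspace scale W" and g: "g \<notin> W"
  shows "\<exists>\<psi>. (\<forall>x y. \<psi> (x + y) = \<psi> x + \<psi> y) \<and> (\<forall>c x. \<psi> (scale c x) = c * \<psi> x)
    \<and> (\<forall>x\<in>W. \<psi> x = 0) \<and> \<psi> g \<noteq> 0"
proof -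
  interpret v1: vector_space scale by (rule vs)
  interpret vector_space_pair scale "(*) :: 'a \<Rightarrow> 'a \<Rightarrow> 'a"
    by (intro vector_space_pair.intro vs vector_space_over_itself.vector_space_axioms)
  obtain B where B: "B \<subseteq> W" "v1.independent B" "W \<subseteq> v1.span B"
    using v1.maximal_independent_subset[of W] by metis
  have "v1.span B \<subseteq> W" using B(1) W by (rule v1.span_minimal)
  then have "v1.independent (insert g B)" using B(2) g v1.independent_insertI[of g B] by blast
  then obtain \<psi> where \<psi>: "Vector_Spaces.linear scale (*) \<psi>"
      "\<And>x. x \<in> insert g B \<Longrightarrow> \<psi> x = (if x = g then 1 else 0)"
    using linear_independent_extend[of "insert g B" "\<lambda>x. if x = g then 1 else 0"] by metis
  interpret l: Vector_Spaces.linear scale "(*)" \<psi> by (rule \<psi>(1))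
  have "\<psi> x = 0" if "x \<in> v1.span B" for x
    using that
  proof (induction rule: v1.span_induct_alt)
    case base
    show ?case by (rule l.zero)
  next
    case (step c x y)
    then have "x \<noteq> g" "x \<in> insert g B" using B g by auto
    then show ?case using step \<psi>(2)[of x] by (simp add: l.add l.scale)
  qed
  then show ?thesis
    using B(3) l.add l.scale \<psi>(2)[of g] by (intro exI[of _ \<psi>]) auto
qed

section \<open>Kernels on weighted index sets\<close>

text \<open>Fubini for an absolutely summable \<open>w\<close>, uniformly summable rows of
  \<open>K\<close> and a merely bounded \<open>v\<close>. It serves to transpose kernels, to apply a
  kernel termwise to a series (with \<open>v = 1\<close>), and to prove associativity of the twisted
  convolution.\<close>

lemma infsum_swap_kernel:
  fixes w :: "'a \<Rightarrow> complex" and K :: "'a \<Rightarrow> 'b \<Rightarrow> complex" and v :: "'b \<Rightarrow> complex"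
  assumes w: "(\<lambda>x. norm (w x)) summable_on UNIV"
    and K: "\<And>x. (\<lambda>y. norm (K x y)) summable_on UNIV" "\<And>x. (\<Sum>\<^sub>\<infinity>y. norm (K x y)) \<le> C"
    and v: "\<And>y. norm (v y) \<le> V"
  shows "(\<Sum>\<^sub>\<infinity>x. w x * (\<Sum>\<^sub>\<infinity>y. K x y * v y)) = (\<Sum>\<^sub>\<infinity>y. (\<Sum>\<^sub>\<infinity>x. w x * K x y) * v y)"
proof -
  have V: "0 \<le> V" using v[of undefined] norm_ge_zero order_trans by blast
  have b: "norm (w x * K x y * v y) \<le> norm (w x) * V * norm (K x y)" for x y
    using v[of y] mult_left_mono[of "norm (v y)" V "norm (w x) * norm (K x y)"]
    by (simp add: norm_mult mult_ac)
  have s1: "(\<lambda>y. norm (w x * K x y * v y)) summable_on UNIV" for x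
    by (rule summable_on_comparison_test[OF summable_on_cmult_right[OF K(1)[of x], of "norm (w x) * V"]])
      (use b in auto)
  have "(\<Sum>\<^sub>\<infinity>y. norm (w x * K x y * v y)) \<le> norm (w x) * (V * C)" for x
  proof -
    have "(\<Sum>\<^sub>\<infinity>y. norm (w x * K x y * v y)) \<le> (\<Sum>\<^sub>\<infinity>y. norm (w x) * V * norm (K x y))"
      by (intro infsum_mono s1 summable_on_cmult_right K b)
    also have "\<dots> = norm (w x) * V * (\<Sum>\<^sub>\<infinity>y. norm (K x y))" by (rule infsum_cmult_right')
    also have "\<dots> \<le> norm (w x) * V * C" by (intro mult_left_mono K) (use V in auto)
    finally show ?thesis by (simp add: mult_ac)
  qed
  then have s2: "(\<lambda>x. \<Sum>\<^sub>\<infinity>y. norm (w x * K x y * v y)) summable_on UNIV"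
    by (intro summable_on_comparison_test[OF summable_on_cmult_left[OF w, of "V * C"]])
      (auto intro!: infsum_nonneg)
  have "(\<lambda>p. norm ((\<lambda>(x, y). w x * K x y * v y) p)) summable_on (UNIV \<times> UNIV)"
    using s1 s2
    by (subst Infinite_Sum.abs_summable_on_Sigma_iff)
      (auto simp: summable_on_cong[OF abs_of_nonneg] infsum_nonneg)
  then have "(\<lambda>(x, y). w x * K x y * v y) summable_on (UNIV \<times> UNIV)"
    by (rule abs_summable_summable)
  from infsum_swap_banach[OF this]
  have "(\<Sum>\<^sub>\<infinity>x. \<Sum>\<^sub>\<infinity>y. w x * K x y * v y) = (\<Sum>\<^sub>\<infinity>y. \<Sum>\<^sub>\<infinity>x. w x * K x y * v y)" .
  then show ?thesis
    by (simp add: infsum_cmult_right'[symmetric] infsum_cmult_left'[symmetric] mult.assoc)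
qed

text \<open>Instantiated twice: by the lattice indexing the coefficients of one algebra element, and
  by the index set of column vectors.\<close>

locale weighted_index =
  fixes s :: "'i \<Rightarrow> real"
  assumes s_ge_1: "1 \<le> s x"
    and finite_sublevel: "finite {x. s x \<le> r}"
    and weight_summable: "\<exists>N. (\<lambda>x. 1 / s x ^ N) summable_on UNIV"
begin

definition decays :: "('i \<Rightarrow> complex) \<Rightarrow> bool" where
  "decays v \<longleftrightarrow> (\<forall>k::nat. \<exists>C. \<forall>x. norm (v x) * s x ^ k \<le> C)"

text \<open>A weighted Schur test: for each \<open>k\<close>, families of size
  \<open>s ^ (-k)\<close> are mapped to families of size \<open>s ^ (-k)\<close>, without loss of
  powers. The case \<open>k = 0\<close> bounds the row sums.\<close>

definition tame :: "('i \<Rightarrow> 'i \<Rightarrow> complex) \<Rightarrow> bool" where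
  "tame K \<longleftrightarrow> (\<forall>k::nat. \<exists>C. \<forall>x. (\<lambda>y. norm (K x y) / s y ^ k) summable_on UNIV \<and>
     (\<Sum>\<^sub>\<infinity>y. norm (K x y) / s y ^ k) * s x ^ k \<le> C)"

definition app :: "('i \<Rightarrow> 'i \<Rightarrow> complex) \<Rightarrow> ('i \<Rightarrow> complex) \<Rightarrow> 'i \<Rightarrow> complex" where
  "app K v x = (\<Sum>\<^sub>\<infinity>y. K x y * v y)"

lemma s_pos [simp]: "0 < s x" "0 \<le> s x" "s x \<noteq> 0"
  using s_ge_1[of x] by auto

lemma decays_add: "decays u \<Longrightarrow> decays v \<Longrightarrow> decays (\<lambda>x. u x + v x)"
  unfolding decays_def
proof
  fix k assume a: "\<forall>k. \<exists>C. \<forall>x. norm (u x) * s x ^ k \<le> C" "\<forall>k. \<exists>C. \<forall>x. norm (v x) * s x ^ k \<le> C"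
  obtain C D where "\<And>x. norm (u x) * s x ^ k \<le> C" "\<And>x. norm (v x) * s x ^ k \<le> D"
    using a by metis
  then have "norm (u x + v x) * s x ^ k \<le> C + D" for x
    using mult_right_mono[OF norm_triangle_ineq[of "u x" "v x"], of "s x ^ k"]
    by (smt (verit) distrib_right s_pos(2) zero_le_power)
  then show "\<exists>C. \<forall>x. norm (u x + v x) * s x ^ k \<le> C" by blast
qed

lemma decays_poly_mult:
  assumes "decays v" "\<And>x. norm (l x) \<le> c * s x ^ N"
  shows "decays (\<lambda>x. l x * v x)"
  unfolding decays_def
proof
  fix k
  obtain C where C: "\<And>x. norm (v x) * s x ^ (k + N) \<le> C"
    using assms(1) unfolding decays_def by metis
  have c: "0 \<le> c" using assms(2)[of undefined]
    by (smt (verit) norm_ge_zero s_pos(1) zero_less_power mult_neg_pos)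
  have "norm (l x * v x) * s x ^ k \<le> c * C" for x
  proof -
    have "norm (l x * v x) * s x ^ k \<le> (c * s x ^ N) * norm (v x) * s x ^ k"
      by (simp add: norm_mult assms(2) mult_right_mono)
    also have "\<dots> = c * (norm (v x) * s x ^ (k + N))" by (simp add: power_add mult_ac)
    also have "\<dots> \<le> c * C" using C c by (intro mult_left_mono)
    finally show ?thesis .
  qed
  then show "\<exists>C. \<forall>x. norm (l x * v x) * s x ^ k \<le> C" by blast
qed

lemma decays_scale: "decays v \<Longrightarrow> decays (\<lambda>x. c * v x)"
  by (rule decays_poly_mult[where c = "norm c" and N = 0]) auto

lemma decays_finite_support:
  assumes "finite {x. v x \<noteq> 0}"
  shows "decays v"
  unfolding decays_def
proof
  fix k
  have "norm (v x) * s x ^ k \<le> (\<Sum>y\<in>{x. v x \<noteq> 0}. norm (v y) * s y ^ k)" for x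
    using member_le_sum[OF _ _ assms, of x "\<lambda>y. norm (v y) * s y ^ k"]
    by (cases "v x = 0") (auto intro!: sum_nonneg)
  then show "\<exists>C. \<forall>x. norm (v x) * s x ^ k \<le> C" by blast
qed

lemma decays_bounded:
  assumes "decays v"
  obtains C where "\<And>x. norm (v x) \<le> C"
  using assms unfolding decays_def by (metis mult.right_neutral power_0)

lemma decays_abs_summable:
  assumes "decays v"
  shows "(\<lambda>x. norm (v x)) summable_on UNIV"
proof -
  obtain N where N: "(\<lambda>x. 1 / s x ^ N) summable_on UNIV" using weight_summable by blast
  obtain C where C: "\<And>x. norm (v x) * s x ^ N \<le> C" using assms unfolding decays_def by metis
  have "norm (v x) \<le> C * (1 / s x ^ N)" for x
    using C[of x] by (simp add: pos_le_divide_eq)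
  then show ?thesis
    by (intro summable_on_comparison_test[OF summable_on_cmult_right[OF N, of C]]) auto
qed

section \<open>Tame kernels as operators on decaying families\<close>

lemma tame_abs_summable: "tame K \<Longrightarrow> (\<lambda>y. norm (K x y)) summable_on UNIV"
  unfolding tame_def by (metis (no_types, lifting) div_by_1 power_0 summable_on_cong)

lemma tame_row_bound:
  assumes "tame K"
  obtains R where "0 < R" "\<And>x. (\<Sum>\<^sub>\<infinity>y. norm (K x y)) \<le> R"
proof -
  obtain C where "\<And>x. (\<Sum>\<^sub>\<infinity>y. norm (K x y) / s y ^ 0) * s x ^ 0 \<le> C"
    using assms unfolding tame_def by metis
  then have "(\<Sum>\<^sub>\<infinity>y. norm (K x y)) \<le> max C 1" for x by (simp add: le_max_iff_disj)
  then show thesis by (intro that[of "max C 1"]) auto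
qed

lemma app_bound:
  assumes K: "(\<lambda>y. norm (K x y) / s y ^ k) summable_on UNIV" and v: "\<And>y. norm (v y) * s y ^ k \<le> C"
  shows "(\<lambda>y. norm (K x y * v y)) summable_on UNIV"
    "norm (app K v x) \<le> (\<Sum>\<^sub>\<infinity>y. norm (K x y) / s y ^ k) * C"
proof -
  have b: "norm (K x y * v y) \<le> norm (K x y) / s y ^ k * C" for y
    using mult_left_mono[OF v[of y], of "norm (K x y) / s y ^ k"] by (simp add: norm_mult)
  note KC = summable_on_cmult_left[OF K, of C]
  show s: "(\<lambda>y. norm (K x y * v y)) summable_on UNIV"
    by (rule summable_on_comparison_test[OF KC]) (use b in auto)
  have "norm (app K v x) \<le> (\<Sum>\<^sub>\<infinity>y. norm (K x y * v y))"
    unfolding app_def by (rule norm_infsum_bound[OF s])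
  also have "\<dots> \<le> (\<Sum>\<^sub>\<infinity>y. norm (K x y) / s y ^ k * C)" by (intro infsum_mono s KC b)
  also have "\<dots> = (\<Sum>\<^sub>\<infinity>y. norm (K x y) / s y ^ k) * C" by (rule infsum_cmult_left')
  finally show "norm (app K v x) \<le> (\<Sum>\<^sub>\<infinity>y. norm (K x y) / s y ^ k) * C" .
qed

lemma app_summable:
  assumes "tame K" "decays v"
  shows "(\<lambda>y. K x y * v y) summable_on UNIV"
proof -
  obtain C where C: "\<And>y. norm (v y) * s y ^ 0 \<le> C" using assms(2) decays_bounded by auto
  show ?thesis
    by (rule abs_summable_summable)
      (rule app_bound(1)[where k = 0, OF _ C], use tame_abs_summable[OF assms(1)] in simp)
qed

lemma app_weighted_bound:
  assumes "tame K" and v: "\<And>y. norm (v y) * s y ^ k \<le> C"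
  obtains C' where "\<And>x. norm (app K v x) * s x ^ k \<le> C'"
proof -
  obtain B where B: "\<And>x. (\<lambda>y. norm (K x y) / s y ^ k) summable_on UNIV"
     "\<And>x. (\<Sum>\<^sub>\<infinity>y. norm (K x y) / s y ^ k) * s x ^ k \<le> B"
    using assms(1) unfolding tame_def by metis
  have C: "0 \<le> C" using v[of undefined] by (smt (verit) norm_ge_zero s_pos(2) zero_le_mult_iff zero_le_power)
  have "norm (app K v x) * s x ^ k \<le> B * C" for x
  proof -
    have "norm (app K v x) * s x ^ k \<le> (\<Sum>\<^sub>\<infinity>y. norm (K x y) / s y ^ k) * C * s x ^ k"
      by (intro mult_right_mono app_bound(2) B v) auto
    also have "\<dots> = (\<Sum>\<^sub>\<infinity>y. norm (K x y) / s y ^ k) * s x ^ k * C" by (simp add: mult_ac)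
    also have "\<dots> \<le> B * C" by (intro mult_right_mono B C)
    finally show ?thesis .
  qed
  then show thesis by (rule that)
qed

lemma decays_app: "tame K \<Longrightarrow> decays v \<Longrightarrow> decays (app K v)"
  unfolding decays_def by (metis app_weighted_bound)

lemma app_transpose:
  assumes "tame K" "decays w" "decays v"
  shows "(\<Sum>\<^sub>\<infinity>x. w x * app K v x) = (\<Sum>\<^sub>\<infinity>y. app (\<lambda>y x. K x y) w y * v y)"
proof -
  obtain R where R: "\<And>x. (\<Sum>\<^sub>\<infinity>y. norm (K x y)) \<le> R" using tame_row_bound[OF assms(1)] by metis
  obtain V where V: "\<And>y. norm (v y) \<le> V" using decays_bounded[OF assms(3)] by metis
  show ?thesis
    using infsum_swap_kernel[OF decays_abs_summable[OF assms(2)] tame_abs_summable[OF assms(1)] R V]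
    by (simp add: app_def mult.commute)
qed

text \<open>The equation reads \<open>v = (g - K v) / l\<close>, and
  \<open>2 * R \<le> norm (l x)\<close> makes \<open>v \<mapsto> K v / l\<close> a contraction with
  factor 1/2 in the sup norm. The \<open>u k\<close> are the terms of the resulting Neumann
  series.\<close>

lemma neumann_bounded_solution:
  assumes K: "tame K" and R: "0 < R" "\<And>x. (\<Sum>\<^sub>\<infinity>y. norm (K x y)) \<le> R"
    and l: "\<And>x. 2 * R \<le> norm (l x)" and g: "\<And>x. norm (g x) \<le> G"
  obtains v C where "\<And>x. norm (v x) \<le> C" "\<And>x. l x * v x + app K v x = g x"
proof -
  define u where "u = rec_nat (\<lambda>x. g x / l x) (\<lambda>_ u x. - app K u x / l x)"
  have u0: "u 0 x = g x / l x" and uS: "u (Suc k) x = - app K (u k) x / l x" for k x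
    by (simp_all add: u_def)
  note Ks = tame_abs_summable[OF K]
  have lp: "0 < norm (l x)" for x using l[of x] R by linarith
  \<comment> \<open>Bounds the first term \<open>g / l\<close>; every further term gains a factor
    1/2.\<close>
  define B where "B = G / (2 * R)"
  have "0 \<le> G" using g[of undefined] norm_ge_zero order_trans by blast
  have u_le: "norm (u k x) \<le> B * (1/2) ^ k" for k x
  proof (induction k arbitrary: x)
    case 0
    have "norm (g x) / norm (l x) \<le> G / (2 * R)" using \<open>0 \<le> G\<close> R l g by (intro frac_le) auto
    then show ?case by (simp add: u0 norm_divide B_def)
  next
    case (Suc k)
    have "norm (app K (u k) x) \<le> (\<Sum>\<^sub>\<infinity>y. norm (K x y) / s y ^ 0) * (B * (1/2) ^ k)"
      by (rule app_bound(2)) (use Ks Suc in auto)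
    also have "\<dots> \<le> R * (B * (1/2) ^ k)"
      using R \<open>0 \<le> G\<close> by (intro mult_right_mono) (auto simp: B_def)
    finally have "norm (app K (u k) x) / norm (l x) \<le> R * (B * (1/2) ^ k) / (2 * R)"
      using R l \<open>0 \<le> G\<close> by (intro frac_le) (auto simp: B_def)
    then show ?case using R by (simp add: uS norm_divide)
  qed
  have geo: "(\<lambda>k. B * (1/2) ^ k) summable_on (UNIV :: nat set)"
    by (intro summable_on_cmult_right norm_summable_imp_summable_on) (simp add: power_abs)
  have us: "(\<lambda>k. norm (u k x)) summable_on UNIV" for x
    by (rule summable_on_comparison_test[OF geo]) (use u_le in auto)
  have usum: "(\<lambda>k. u k x) summable_on UNIV" for x by (rule abs_summable_summable[OF us])
  define C where "C = (\<Sum>\<^sub>\<infinity>k::nat. B * (1/2) ^ k)"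
  have uC: "(\<Sum>\<^sub>\<infinity>k. norm (u k x)) \<le> C" for x
    unfolding C_def by (intro infsum_mono us geo u_le)
  define v where "v x = (\<Sum>\<^sub>\<infinity>k. u k x)" for x
  have "l x * v x + app K v x = g x" for x
  proof -
    \<comment> \<open>\<open>K\<close> is applied termwise. As
      \<open>K (u k) = - l * u (Suc k)\<close>, the outcome is the series for \<open>- l * v\<close>
      without its first term \<open>- l * u 0 = - g\<close>.\<close>
    have "app K v x = (\<Sum>\<^sub>\<infinity>k. (\<Sum>\<^sub>\<infinity>y. K x y * u k y) * 1)"
      unfolding app_def v_def
      using infsum_swap_kernel[OF Ks us uC, of "\<lambda>_. 1" 1] by simp
    also have "\<dots> = (\<Sum>\<^sub>\<infinity>k. - l x * u (Suc k) x)"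
      using lp[of x] by (intro infsum_cong) (simp add: uS app_def)
    also have "\<dots> = - l x * (\<Sum>\<^sub>\<infinity>k. u (Suc k) x)" by (rule infsum_cmult_right')
    also have "(\<Sum>\<^sub>\<infinity>k. u (Suc k) x) = v x - u 0 x"
    proof -
      have "(\<Sum>\<^sub>\<infinity>k. u (Suc k) x) = infsum (\<lambda>k. u k x) (range Suc)"
        by (subst infsum_reindex) (auto simp: o_def)
      also have "range Suc = UNIV - {0}" using image_Suc_atLeastLessThan by (auto simp: image_iff) (metis not0_implies_Suc)
      also have "infsum (\<lambda>k. u k x) (UNIV - {0}) = v x - infsum (\<lambda>k. u k x) {0}"
        unfolding v_def by (rule infsum_Diff) (use usum in auto)
      finally show ?thesis by simp
    qed
    finally show ?thesis using lp[of x] by (simp add: u0 algebra_simps)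
  qed
  moreover have "norm (v x) \<le> C" for x
    unfolding v_def using norm_infsum_bound[OF us] uC order_trans by blast
  ultimately show thesis using that by blast
qed

text \<open>Once \<open>|l|\<close> grows like \<open>s\<close>, each application of \<open>v = (g - K v) / l\<close> gains one power of \<open>s\<close>.\<close>

lemma elliptic_regularity:
  assumes K: "tame K" and g: "decays g" and v: "\<And>x. norm (v x) \<le> C"
    and c: "0 < c" "\<And>x. c * s x \<le> norm (l x)" and eq: "\<And>x. l x * v x + app K v x = g x"
  shows "decays v"
  unfolding decays_def
proof
  fix k show "\<exists>C. \<forall>x. norm (v x) * s x ^ k \<le> C"
  proof (induction k)
    case 0 then show ?case using v by auto
  next
    case (Suc k)
    then obtain A where "\<And>x. norm (v x) * s x ^ k \<le> A" by blast
    then obtain A' where A': "\<And>x. norm (app K v x) * s x ^ k \<le> A'"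
      using app_weighted_bound[OF K] by metis
    obtain G where G: "\<And>x. norm (g x) * s x ^ k \<le> G" using g unfolding decays_def by metis
    have "norm (v x) * s x ^ Suc k \<le> (G + A') / c" for x
    proof -
      have "c * (norm (v x) * s x ^ Suc k) = (c * s x) * norm (v x) * s x ^ k" by simp
      also have "\<dots> \<le> norm (l x) * norm (v x) * s x ^ k" by (intro mult_right_mono c) auto
      also have "\<dots> = norm (g x - app K v x) * s x ^ k"
        using eq[of x] by (metis add_diff_cancel_right' norm_mult)
      also have "\<dots> \<le> (norm (g x) + norm (app K v x)) * s x ^ k"
        by (intro mult_right_mono norm_triangle_ineq4) auto
      also have "\<dots> \<le> G + A'" using G[of x] A'[of x] by (simp add: distrib_right)
      finally show ?thesis using c by (simp add: field_simps)
    qed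
    then show ?case by blast
  qed
qed

text \<open>The two lower bounds on \<open>l\<close> have separate tasks: \<open>2 * R\<close> gives
  a bounded solution, growth like \<open>s\<close> makes it decay.\<close>

lemma dominant_diagonal_surj:
  assumes K: "tame K" and R: "0 < R" "\<And>x. (\<Sum>\<^sub>\<infinity>y. norm (K x y)) \<le> R"
    and l: "\<And>x. 2 * R \<le> norm (l x)" and c: "0 < c" "\<And>x. c * s x \<le> norm (l x)" and g: "decays g"
  obtains v where "decays v" "\<And>x. l x * v x + app K v x = g x"
proof -
  obtain G where "\<And>x. norm (g x) \<le> G" using decays_bounded[OF g] by metis
  then obtain v C where "\<And>x. norm (v x) \<le> C" "\<And>x. l x * v x + app K v x = g x"
    using neumann_bounded_solution[where l = l and g = g and G = G, OF K R l] by (metis (no_types, lifting))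
  with elliptic_regularity[OF K g _ c] that show thesis by blast
qed

end

section \<open>Elliptic operators on rapidly decreasing families\<close>

text \<open>The lower bound on the diagonal is asked for only off a finite set, since the symbol of
  \<open>deltaA\<close> vanishes at the origin.\<close>

locale elliptic_operator = weighted_index s for s :: "'i \<Rightarrow> real" +
  fixes l :: "'i \<Rightarrow> complex" and K :: "'i \<Rightarrow> 'i \<Rightarrow> complex" and c N d
  assumes K: "tame K" and Kt: "tame (\<lambda>x y. K y x)"
    and c: "0 < c" and elliptic: "finite {x. norm (l x) < c * s x}"
    and l_le: "\<And>x. norm (l x) \<le> d * s x ^ N"
begin

definition ell :: "('i \<Rightarrow> complex) \<Rightarrow> 'i \<Rightarrow> complex" where
  "ell v x = l x * v x + app K v x"

text \<open>Bilinear, without conjugation, so that transposition swaps the arguments of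
  \<open>K\<close> and leaves \<open>l\<close> unchanged.\<close>

definition ip :: "('i \<Rightarrow> complex) \<Rightarrow> ('i \<Rightarrow> complex) \<Rightarrow> complex" where
  "ip w v = (\<Sum>\<^sub>\<infinity>x. w x * v x)"

definition unit_vec :: "'i \<Rightarrow> 'i \<Rightarrow> complex" where
  "unit_vec x y = (if y = x then 1 else 0)"

lemma decays_unit_vec: "decays (unit_vec x)"
  by (rule decays_finite_support) (simp add: unit_vec_def)

lemma ip_summable:
  assumes "decays w" "decays v"
  shows "(\<lambda>x. w x * v x) summable_on UNIV"
proof -
  obtain V where V: "\<And>y. norm (v y) \<le> V" using decays_bounded[OF assms(2)] by metis
  then have "norm (w x * v x) \<le> norm (w x) * V" for x
    by (simp add: norm_mult mult_left_mono)
  then have "(\<lambda>x. norm (w x * v x)) summable_on UNIV"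
    by (intro summable_on_comparison_test[OF summable_on_cmult_left[OF decays_abs_summable[OF assms(1)], of V]])
      simp_all
  then show ?thesis by (rule abs_summable_summable)
qed

lemma ip_add:
  assumes "decays w" "decays u" "decays v"
  shows "ip w (\<lambda>x. u x + v x) = ip w u + ip w v" "ip (\<lambda>x. u x + v x) w = ip u w + ip v w"
  unfolding ip_def using assms by (simp_all add: distrib_left distrib_right infsum_add ip_summable)

lemma ip_unit_vec: "ip w (unit_vec x) = w x" "ip (unit_vec x) w = w x"
proof -
  have "ip w (unit_vec x) = infsum (\<lambda>y. w y * unit_vec x y) {x}"
    unfolding ip_def by (rule infsum_cong_neutral) (auto simp: unit_vec_def)
  then show "ip w (unit_vec x) = w x" by (simp add: unit_vec_def)
  then show "ip (unit_vec x) w = w x" by (simp add: ip_def mult.commute)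
qed

lemma decays_ell: "decays v \<Longrightarrow> decays (ell v)"
  unfolding ell_def[abs_def] by (intro decays_add decays_app K decays_poly_mult[OF _ l_le])

text \<open>An arbitrary linear functional is accessible only on finite combinations. The functional
  is a parameter because the lemma is applied to \<phi> and to \<phi> composed with an inverse
  operator.\<close>

lemma finite_support_sum:
  assumes F: "finite F" and y: "\<And>x. x \<notin> F \<Longrightarrow> y x = 0"
    and add: "\<And>u v. decays u \<Longrightarrow> decays v \<Longrightarrow> \<phi> (\<lambda>x. u x + v x) = \<phi> u + \<phi> v"
    and scl: "\<And>a v. decays v \<Longrightarrow> \<phi> (\<lambda>x. a * v x) = a * \<phi> v"
  shows "\<phi> y = (\<Sum>x\<in>F. y x * \<phi> (unit_vec x))"
  using F y
proof (induction F arbitrary: y)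
  case empty
  then have "y = (\<lambda>x. 0 * unit_vec undefined x)" by auto
  then show ?case using scl[OF decays_unit_vec, of 0 undefined] by simp
next
  case (insert z F)
  define y' where "y' = y(z := 0)"
  have y': "\<phi> y' = (\<Sum>x\<in>F. y' x * \<phi> (unit_vec x))"
    by (rule insert.IH) (use insert in \<open>auto simp: y'_def\<close>)
  have "{x. y' x \<noteq> 0} \<subseteq> F" using insert by (auto simp: y'_def)
  then have "decays y'" using insert(1) finite_subset by (intro decays_finite_support) blast
  moreover have "y = (\<lambda>x. y z * unit_vec z x + y' x)" by (auto simp: y'_def unit_vec_def)
  ultimately have "\<phi> y = y z * \<phi> (unit_vec z) + \<phi> y'"
    using add scl decays_scale decays_unit_vec by metis
  moreover have "(\<Sum>x\<in>F. y' x * \<phi> (unit_vec x)) = (\<Sum>x\<in>F. y x * \<phi> (unit_vec x))"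
    using insert(2) by (intro sum.cong) (auto simp: y'_def)
  ultimately show ?case using y' insert by simp
qed

text \<open>A diagonal that dominates the row sums of the kernel makes the operator invertible, so it suffices
  to enlarge the diagonal at the finitely many places where it is small.\<close>

lemma invertible_modification:
  "\<exists>F t. finite F \<and> (\<forall>x. x \<notin> F \<longrightarrow> t x = 0) \<and>
    (\<forall>g. decays g \<longrightarrow> (\<exists>v. decays v \<and> (\<forall>x. ell v x + t x * v x = g x))) \<and>
    (\<forall>g. decays g \<longrightarrow> (\<exists>w. decays w \<and> (\<forall>v. decays v \<longrightarrow> ip w (\<lambda>x. ell v x + t x * v x) = ip g v)))"
proof -
  obtain R1 where R1: "0 < R1" "\<And>x. (\<Sum>\<^sub>\<infinity>y. norm (K x y)) \<le> R1" using tame_row_bound[OF K] by metis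
  obtain R2 where R2: "0 < R2" "\<And>x. (\<Sum>\<^sub>\<infinity>y. norm (K y x)) \<le> R2" using tame_row_bound[OF Kt] by metis
  define R where "R = max R1 R2"
  have R: "0 < R" "\<And>x. (\<Sum>\<^sub>\<infinity>y. norm (K x y)) \<le> R" "\<And>x. (\<Sum>\<^sub>\<infinity>y. norm (K y x)) \<le> R"
    using R1 R2 by (auto simp: R_def le_max_iff_disj)
  \<comment> \<open>Off \<open>F\<close> the old diagonal is at least \<open>c * s\<close>, and
    \<open>c * s\<close> exceeds \<open>2 * R\<close>; so both bounds needed for solvability hold
    there already.\<close>
  define F where "F = {x. norm (l x) < c * s x} \<union> {x. s x \<le> 2 * R / c}"
  define l' where "l' x = (if x \<in> F then complex_of_real (max (c * s x) (2 * R)) else l x)" for x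
  define t where "t x = l' x - l x" for x
  have F: "finite F" unfolding F_def using elliptic finite_sublevel by simp
  have l': "2 * R \<le> norm (l' x)" "c * s x \<le> norm (l' x)" for x
  proof -
    have "2 * R \<le> norm (l' x) \<and> c * s x \<le> norm (l' x)"
    proof (cases "x \<in> F")
      case True
      then have "norm (l' x) = \<bar>max (c * s x) (2 * R)\<bar>" unfolding l'_def by (simp only: if_True norm_of_real)
      then show ?thesis using R(1) by linarith
    next
      case False
      then have "c * s x \<le> norm (l x)" "2 * R / c < s x" by (simp_all add: F_def not_less not_le)
      moreover from this(2) have "2 * R < c * s x" using c by (simp add: pos_divide_less_eq mult.commute)
      ultimately show ?thesis using False by (simp add: l'_def)
    qed
    then show "2 * R \<le> norm (l' x)" "c * s x \<le> norm (l' x)" by auto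
  qed
  have t0: "x \<notin> F \<Longrightarrow> t x = 0" for x by (simp add: t_def l'_def)
  have e: "ell v x + t x * v x = l' x * v x + app K v x" for v x
    by (simp add: ell_def t_def algebra_simps)
  have "\<exists>v. decays v \<and> (\<forall>x. ell v x + t x * v x = g x)" if "decays g" for g
    using dominant_diagonal_surj[where l = l', OF K R(1,2) l'(1) c l'(2) that] unfolding e by metis
  moreover have "\<exists>w. decays w \<and> (\<forall>v. decays v \<longrightarrow> ip w (\<lambda>x. ell v x + t x * v x) = ip g v)"
    if g: "decays g" for g
  proof -
    \<comment> \<open>The second claim is solvability of the transposed equation with the same
      modified diagonal, followed by moving the operator across the pairing.\<close>
    obtain w where w: "decays w" "\<And>x. l' x * w x + app (\<lambda>x y. K y x) w x = g x"
      using dominant_diagonal_surj[where l = l' and K = "\<lambda>x y. K y x", OF Kt R(1,3) l'(1) c l'(2) g] by metis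
    \<comment> \<open>No growth bound is at hand for \<open>l'\<close>, so \<open>l' * w\<close> is
      split into \<open>l * w\<close> and the finitely supported \<open>t * w\<close>.\<close>
    have "{x. t x * w x \<noteq> 0} \<subseteq> F" using t0 by auto
    then have tw: "decays (\<lambda>x. t x * w x)" by (intro decays_finite_support finite_subset[OF _ F])
    have lw: "decays (\<lambda>x. l' x * w x)"
      using decays_add[OF tw decays_poly_mult[OF w(1) l_le]] by (simp add: t_def algebra_simps)
    have "ip w (\<lambda>x. ell v x + t x * v x) = ip g v" if v: "decays v" for v
    proof -
      have "{x. t x * v x \<noteq> 0} \<subseteq> F" using t0 by auto
      then have tv: "decays (\<lambda>x. t x * v x)" by (intro decays_finite_support finite_subset[OF _ F])
      have lv: "decays (\<lambda>x. l' x * v x)"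
        using decays_add[OF tv decays_poly_mult[OF v l_le]] by (simp add: t_def algebra_simps)
      have "ip w (\<lambda>x. ell v x + t x * v x) = ip w (\<lambda>x. l' x * v x) + ip w (app K v)"
        unfolding e by (intro ip_add w lv decays_app K v)
      also have "ip w (app K v) = ip (app (\<lambda>x y. K y x) w) v"
        unfolding ip_def by (rule app_transpose[OF K w(1) v])
      also have "ip w (\<lambda>x. l' x * v x) = ip (\<lambda>x. l' x * w x) v"
        by (simp add: ip_def mult_ac)
      also have "\<dots> + ip (app (\<lambda>x y. K y x) w) v = ip (\<lambda>x. l' x * w x + app (\<lambda>x y. K y x) w x) v"
        by (intro ip_add(2)[symmetric] v lw decays_app Kt w)
      finally show ?thesis by (simp add: w(2))
    qed
    with w(1) show ?thesis by blast
  qed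
  ultimately show ?thesis using F t0 by blast
qed

section \<open>Arbitrary functionals on the cokernel and on the kernel\<close>

context
  fixes \<phi> :: "('i \<Rightarrow> complex) \<Rightarrow> complex"
  assumes add: "\<And>u v. decays u \<Longrightarrow> decays v \<Longrightarrow> \<phi> (\<lambda>x. u x + v x) = \<phi> u + \<phi> v"
    and scl: "\<And>a v. decays v \<Longrightarrow> \<phi> (\<lambda>x. a * v x) = a * \<phi> v"
begin

lemma functional_on_cokernel:
  assumes zero: "\<And>v. decays v \<Longrightarrow> \<phi> (ell v) = 0"
  shows "\<exists>w. decays w \<and> (\<forall>v. decays v \<longrightarrow> \<phi> v = ip w v)"
proof -
  obtain F t where F: "finite F" and t: "\<And>x. x \<notin> F \<Longrightarrow> t x = 0"
    and B: "\<And>g. decays g \<Longrightarrow> \<exists>v. decays v \<and> (\<forall>x. ell v x + t x * v x = g x)"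
    and Bt: "\<And>g. decays g \<Longrightarrow> \<exists>w. decays w \<and> (\<forall>v. decays v \<longrightarrow> ip w (\<lambda>x. ell v x + t x * v x) = ip g v)"
    using invertible_modification by blast
  have dt: "decays (\<lambda>x. t x * v x)" for v
    by (rule decays_finite_support, rule finite_subset[OF _ F]) (use t in auto)
  \<comment> \<open>Pairing with \<open>y\<close> computes \<phi> on \<open>t * v\<close>. Solving
    the transposed equation for \<open>y\<close> rewrites this as a pairing with the right-hand side
    \<open>g\<close>, uniformly in \<open>v\<close>.\<close>
  define y where "y x = t x * \<phi> (unit_vec x)" for x
  obtain w where w: "decays w" "\<And>v. decays v \<Longrightarrow> ip w (\<lambda>x. ell v x + t x * v x) = ip y v"
    using Bt[of y] dt[of "\<lambda>x. \<phi> (unit_vec x)"] unfolding y_def[abs_def] by blast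
  have "\<phi> g = ip w g" if g: "decays g" for g
  proof -
    obtain v where v: "decays v" "\<And>x. ell v x + t x * v x = g x" using B[OF g] by blast
    then have "\<phi> g = \<phi> (\<lambda>x. ell v x + t x * v x)" by presburger
    also have "\<dots> = \<phi> (\<lambda>x. t x * v x)" using add[OF decays_ell dt] zero v(1) by simp
    also have "\<dots> = (\<Sum>x\<in>F. t x * v x * \<phi> (unit_vec x))"
      by (rule finite_support_sum[OF F _ add scl]) (use t in auto)
    also have "\<dots> = (\<Sum>\<^sub>\<infinity>x\<in>F. y x * v x)" using F by (simp add: y_def mult_ac)
    also have "\<dots> = ip y v" unfolding ip_def using t by (intro infsum_cong_neutral) (auto simp: y_def)
    also have "\<dots> = ip w g" using w(2)[OF v(1)] v(2) by simp
    finally show ?thesis .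
  qed
  with w(1) show ?thesis by blast
qed

lemma functional_on_kernel:
  "\<exists>w. decays w \<and> (\<forall>v. decays v \<longrightarrow> ell v = (\<lambda>_. 0) \<longrightarrow> \<phi> v = ip w v)"
proof -
  obtain F t where F: "finite F" and t: "\<And>x. x \<notin> F \<Longrightarrow> t x = 0"
    and B: "\<And>g. decays g \<Longrightarrow> \<exists>v. decays v \<and> (\<forall>x. ell v x + t x * v x = g x)"
    and Bt: "\<And>g. decays g \<Longrightarrow> \<exists>w. decays w \<and> (\<forall>v. decays v \<longrightarrow> ip w (\<lambda>x. ell v x + t x * v x) = ip g v)"
    using invertible_modification by blast
  \<comment> \<open>Surjectivity of the transpose gives injectivity: its solution for
    \<open>unit_vec x\<close> reads off the coordinate at \<open>x\<close> from the image of a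
    family.\<close>
  have inj: "u = v" if uv: "decays u" "decays v" "\<And>x. ell u x + t x * u x = ell v x + t x * v x" for u v
  proof
    fix x
    obtain w where "\<And>v. decays v \<Longrightarrow> ip w (\<lambda>x. ell v x + t x * v x) = ip (unit_vec x) v"
      using Bt[OF decays_unit_vec] by blast
    from this[OF uv(1)] this[OF uv(2)] uv(3) show "u x = v x" by (simp add: ip_unit_vec)
  qed
  \<comment> \<open>The inverse of the modified operator. Although defined by choice it is linear on
    decaying families, since solutions are unique.\<close>
  define b where "b g = (SOME v. decays v \<and> (\<forall>x. ell v x + t x * v x = g x))" for g
  have b: "decays (b g)" "ell (b g) x + t x * b g x = g x" if "decays g" for g x
    using someI_ex[OF B[OF that]] by (auto simp: b_def)
  have ell_add: "ell (\<lambda>x. u x + v x) x = ell u x + ell v x" if "decays u" "decays v" for u v x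
    using app_summable[OF K that(1)] app_summable[OF K that(2)]
    by (simp add: ell_def app_def algebra_simps infsum_add)
  have ell_scale: "ell (\<lambda>x. a * u x) x = a * ell u x" for a u x
    by (simp add: ell_def app_def algebra_simps infsum_cmult_right'[symmetric])
  have b_add: "b (\<lambda>x. g x + h x) = (\<lambda>x. b g x + b h x)" if "decays g" "decays h" for g h
  proof (rule inj)
    fix x
    show "ell (b (\<lambda>x. g x + h x)) x + t x * b (\<lambda>x. g x + h x) x =
      ell (\<lambda>x. b g x + b h x) x + t x * (b g x + b h x)"
      using b(2)[OF that(1), of x] b(2)[OF that(2), of x] b(2)[OF decays_add[OF that], of x]
      by (simp add: ell_add[OF b(1)[OF that(1)] b(1)[OF that(2)]] algebra_simps)
  qed (use that b decays_add in auto)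
  have b_scale: "b (\<lambda>x. a * g x) = (\<lambda>x. a * b g x)" if "decays g" for a g
  proof (rule inj)
    fix x
    show "ell (b (\<lambda>x. a * g x)) x + t x * b (\<lambda>x. a * g x) x =
      ell (\<lambda>x. a * b g x) x + t x * (a * b g x)"
      using arg_cong[OF b(2)[OF that], of "\<lambda>z. a * z" x] b(2)[OF decays_scale[OF that], of a x]
      by (simp add: ell_scale algebra_simps)
  qed (use that b decays_scale in auto)
  \<comment> \<open>A kernel element is \<open>b (t * v)\<close>, so \<phi> is evaluated on finitely
    many \<open>b (unit_vec x)\<close>; hence \<open>w\<close> is even finitely supported.\<close>
  define w where "w x = t x * \<phi> (b (unit_vec x))" for x
  have "decays w"
    by (rule decays_finite_support, rule finite_subset[OF _ F]) (use t in \<open>auto simp: w_def\<close>)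
  moreover have "\<phi> v = ip w v" if v: "decays v" "ell v = (\<lambda>_. 0)" for v
  proof -
    have dt: "decays (\<lambda>x. t x * v x)"
      by (rule decays_finite_support, rule finite_subset[OF _ F]) (use t in auto)
    have "b (\<lambda>x. t x * v x) = v"
      by (rule inj) (use b[OF dt] v in auto)
    then have "\<phi> v = \<phi> (b (\<lambda>x. t x * v x))" by simp
    also have "\<dots> = (\<Sum>x\<in>F. t x * v x * \<phi> (b (unit_vec x)))"
      by (rule finite_support_sum[OF F, of _ "\<lambda>g. \<phi> (b g)"])
        (use t in \<open>auto simp: b_add b_scale b add scl\<close>)
    also have "\<dots> = (\<Sum>\<^sub>\<infinity>x\<in>F. w x * v x)" using F by (simp add: w_def mult_ac)
    also have "\<dots> = ip w v" unfolding ip_def using t by (intro infsum_cong_neutral) (auto simp: w_def)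
    finally show ?thesis .
  qed
  ultimately show ?thesis by blast
qed

end

lemma ip_ell:
  assumes "decays w" "decays v"
  shows "ip w (ell v) = ip (\<lambda>x. l x * w x + app (\<lambda>x y. K y x) w x) v"
proof -
  note lv = decays_poly_mult[OF assms(2) l_le] and lw = decays_poly_mult[OF assms(1) l_le]
  have "ip w (ell v) = ip w (\<lambda>x. l x * v x) + ip w (app K v)"
    unfolding ell_def[abs_def] by (intro ip_add assms lv decays_app K)
  also have "ip w (app K v) = ip (app (\<lambda>x y. K y x) w) v"
    unfolding ip_def by (rule app_transpose[OF K assms])
  also have "ip w (\<lambda>x. l x * v x) = ip (\<lambda>x. l x * w x) v"
    by (simp add: ip_def mult_ac)
  also have "\<dots> + ip (app (\<lambda>x y. K y x) w) v = ip (\<lambda>x. l x * w x + app (\<lambda>x y. K y x) w x) v"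
    by (intro ip_add(2)[symmetric] assms lw decays_app Kt)
  finally show ?thesis .
qed

lemma elliptic_operator_transpose: "elliptic_operator s l (\<lambda>x y. K y x) c N d"
  by unfold_locales (use K Kt c elliptic l_le in auto)

end

section \<open>The smooth noncommutative torus\<close>

definition wt :: "int \<times> int \<Rightarrow> real" where
  "wt x = 1 + real_of_int (\<bar>fst x\<bar> + \<bar>snd x\<bar>)"

text \<open>Writing \<open>U^(m,n)\<close> for \<open>U1^m U2^n\<close>, one has \<open>U^x U^y = tw \<theta> x y U^(x+y)\<close>.\<close>

definition tw :: "real \<Rightarrow> int \<times> int \<Rightarrow> int \<times> int \<Rightarrow> complex" where
  "tw \<theta> x y = exp (- 2 * of_real pi * \<i> * of_real \<theta> * of_int (snd x) * of_int (fst y))"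

text \<open>Reduces sums over the infinitely many rows of \<open>nat \<times> 'a\<close> to the
  first \<open>n\<close>, so that one index type serves every rank.\<close>

lemma has_sum_strip:
  fixes f :: "nat \<times> 'a \<Rightarrow> 'b :: {comm_monoid_add, t2_space, topological_comm_monoid_add}"
  assumes "\<And>j. j < n \<Longrightarrow> ((\<lambda>y. f (j, y)) has_sum S j) UNIV" and "\<And>j y. n \<le> j \<Longrightarrow> f (j, y) = 0"
  shows "(f has_sum (\<Sum>j<n. S j)) UNIV"
proof -
  have "(f has_sum (\<Sum>j<m. S j)) ({..<m} \<times> UNIV)" if "m \<le> n" for m
    using that
  proof (induction m)
    case 0
    then show ?case by simp
  next
    case (Suc m)
    have "(f has_sum S m) (Pair m ` UNIV)"
      using assms(1)[of m] Suc by (subst has_sum_reindex) (auto simp: o_def inj_on_def)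
    then have "(f has_sum (\<Sum>j<m. S j) + S m) (({..<m} \<times> UNIV) \<union> (Pair m ` UNIV))"
      using Suc by (intro has_sum_Un_disjoint) auto
    moreover have "({..<m} \<times> UNIV) \<union> (Pair m ` UNIV) = {..<Suc m} \<times> (UNIV :: 'a set)"
      by (auto simp: less_Suc_eq)
    ultimately show ?case by simp
  qed
  moreover have "f p = 0" if "p \<notin> {..<n} \<times> UNIV" for p
    using assms(2)[of "fst p" "snd p"] that by (cases p) auto
  then have "(f has_sum (\<Sum>j<n. S j)) ({..<n} \<times> UNIV) \<longleftrightarrow> (f has_sum (\<Sum>j<n. S j)) UNIV"
    by (intro has_sum_cong_neutral) auto
  ultimately show ?thesis by blast
qed

lemma wt_ge_1 [simp]: "1 \<le> wt x" and wt_pos [simp]: "0 < wt x" "0 \<le> wt x"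
  by (simp_all add: wt_def)

lemma wt_minus [simp]: "wt (- x) = wt x"
  by (simp add: wt_def)

text \<open>Submultiplicativity is behind all convolution estimates: a weight at \<open>z\<close> is
  paid for by weights at \<open>x\<close> and at \<open>z - x\<close>.\<close>

lemma wt_add: "wt (x + y) \<le> wt x * wt y"
proof -
  have "wt (x + y) \<le> 1 + (wt x - 1) + (wt y - 1)"
    unfolding wt_def by simp
  also have "\<dots> \<le> 1 + (wt x - 1) + (wt y - 1) + (wt x - 1) * (wt y - 1)" by simp
  also have "\<dots> = wt x * wt y" by (simp add: algebra_simps)
  finally show ?thesis .
qed

lemma finite_wt_sublevel: "finite {x. wt x \<le> r}"
proof (rule finite_subset)
  show "{x. wt x \<le> r} \<subseteq> {-\<lceil>r\<rceil>..\<lceil>r\<rceil>} \<times> {-\<lceil>r\<rceil>..\<lceil>r\<rceil>}"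
  proof
    fix x assume "x \<in> {x. wt x \<le> r}"
    then have "real_of_int (\<bar>fst x\<bar> + \<bar>snd x\<bar>) \<le> real_of_int \<lceil>r\<rceil>"
      unfolding wt_def using le_of_int_ceiling[of r] by (simp only: mem_Collect_eq)
    then have "\<bar>fst x\<bar> + \<bar>snd x\<bar> \<le> \<lceil>r\<rceil>" by (simp only: of_int_le_iff)
    then show "x \<in> {-\<lceil>r\<rceil>..\<lceil>r\<rceil>} \<times> {-\<lceil>r\<rceil>..\<lceil>r\<rceil>}" by (cases x) auto
  qed
qed auto

lemma summable_on_prod_mult:
  fixes f :: "'a \<Rightarrow> real" and g :: "'b \<Rightarrow> real"
  assumes "f summable_on UNIV" "g summable_on UNIV" and "\<And>x. 0 \<le> f x" "\<And>y. 0 \<le> g y"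
  shows "(\<lambda>p. f (fst p) * g (snd p)) summable_on UNIV"
proof -
  have "(\<lambda>p. norm (f (fst p) * g (snd p))) summable_on (UNIV \<times> UNIV)"
    using assms by (subst Infinite_Sum.abs_summable_on_Sigma_iff)
      (auto simp: infsum_cmult_right' infsum_nonneg abs_mult
        intro!: summable_on_cmult_right summable_on_cmult_left)
  then show ?thesis using assms(3,4) by (simp add: abs_mult)
qed

lemma summable_on_nat_inverse_square: "(\<lambda>k::nat. 1 / (1 + real k) ^ 2) summable_on UNIV"
proof -
  have "summable (\<lambda>k::nat. inverse (of_nat (Suc k) ^ 2) :: real)"
    by (subst summable_Suc_iff) (rule inverse_power_summable, simp)
  then show ?thesis
    by (intro norm_summable_imp_summable_on) (simp add: field_simps)
qed

lemma summable_on_int_inverse_square: "(\<lambda>m::int. 1 / (1 + real_of_int \<bar>m\<bar>) ^ 2) summable_on UNIV"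
proof -
  note nat = summable_on_nat_inverse_square
  have 1: "(\<lambda>m::int. 1 / (1 + real_of_int \<bar>m\<bar>) ^ 2) summable_on (range int)"
    using nat by (subst summable_on_reindex) (auto simp: o_def inj_on_def)
  have 2: "(\<lambda>m::int. 1 / (1 + real_of_int \<bar>m\<bar>) ^ 2) summable_on (range (\<lambda>k. - int k))"
    using nat by (subst summable_on_reindex) (auto simp: o_def inj_on_def)
  \<comment> \<open>Zero lies in both ranges, hence the set difference.\<close>
  have "(UNIV :: int set) = range int \<union> (range (\<lambda>k. - int k) - range int)"
    using int_cases by (auto simp: image_iff) (metis int_cases2)
  moreover have "(\<lambda>m::int. 1 / (1 + real_of_int \<bar>m\<bar>) ^ 2) summable_on
      (range int \<union> (range (\<lambda>k. - int k) - range int))"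
    by (rule summable_on_Un_disjoint[OF 1 summable_on_subset_banach[OF 2]]) auto
  ultimately show ?thesis by simp
qed

lemma summable_on_wt: "(\<lambda>x. 1 / wt x ^ 4) summable_on UNIV"
proof -
  define q where "q m = 1 / (1 + real_of_int \<bar>m\<bar>) ^ 2" for m
  have q: "q summable_on UNIV" "\<And>m. 0 \<le> q m"
    using summable_on_int_inverse_square by (auto simp: q_def[abs_def])
  have "(\<lambda>x. q (fst x) * q (snd x)) summable_on UNIV"
    using q by (intro summable_on_prod_mult)
  moreover have "1 / wt x ^ 4 \<le> q (fst x) * q (snd x)" for x
  proof -
    obtain m n where x: "x = (m, n)" by (cases x)
    \<comment> \<open>Both \<open>1 + \<bar>m\<bar>\<close> and \<open>1 + \<bar>n\<bar>\<close> are
      at most \<open>wt x\<close>; the fourth power leaves an inverse square for each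
      variable.\<close>
    have "(1 + real_of_int \<bar>m\<bar>) ^ 2 * (1 + real_of_int \<bar>n\<bar>) ^ 2 \<le> wt x ^ 2 * wt x ^ 2"
      by (intro mult_mono power_mono) (auto simp: wt_def x)
    also have "\<dots> = wt x ^ 4" by (simp flip: power_add)
    finally have "1 / wt x ^ 4 \<le> 1 / ((1 + real_of_int \<bar>m\<bar>) ^ 2 * (1 + real_of_int \<bar>n\<bar>) ^ 2)"
      by (intro divide_left_mono mult_pos_pos zero_less_power) auto
    then show ?thesis by (simp add: x q_def)
  qed
  ultimately show ?thesis
    by (rule summable_on_comparison_test) simp
qed

interpretation Z2: weighted_index wt
  by (rule weighted_index.intro) (rule wt_ge_1, rule finite_wt_sublevel, rule exI[of _ 4], rule summable_on_wt)

lemma rapid_iff_decays: "rapid a \<longleftrightarrow> Z2.decays a"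
  by (simp add: rapid_def Z2.decays_def wt_def)

lemma Ath_iff: "a \<in> Ath \<longleftrightarrow> Z2.decays a"
  by (simp add: Ath_def rapid_iff_decays)

section \<open>The twisted convolution algebra, its derivation and its trace\<close>

lemma addA_eq: "addA = (+)" and zeroA_eq: "zeroA = 0"
  by (auto simp: addA_def zeroA_def fun_eq_iff)

lemma tw_add_left: "tw \<theta> (x + y) z = tw \<theta> x z * tw \<theta> y z"
  and tw_add_right: "tw \<theta> x (y + z) = tw \<theta> x y * tw \<theta> x z"
  by (simp_all add: tw_def exp_add[symmetric] algebra_simps)

lemma tw_0 [simp]: "tw \<theta> 0 y = 1" "tw \<theta> x 0 = 1"
  by (simp_all add: tw_def)

lemma tw_nonzero [simp]: "tw \<theta> x y \<noteq> 0"
  by (simp add: tw_def)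

lemma norm_tw [simp]: "norm (tw \<theta> x y) = 1"
  by (simp add: tw_def)

lemma mulA_conv: "mulA \<theta> a b z = (\<Sum>\<^sub>\<infinity>x. a x * b (z - x) * tw \<theta> x (z - x))"
  by (cases z) (auto simp: mulA_def tw_def intro!: infsum_cong)

lemma Ath_add [intro, simp]: "a \<in> Ath \<Longrightarrow> b \<in> Ath \<Longrightarrow> a + b \<in> Ath"
  by (simp add: Ath_iff plus_fun_def Z2.decays_add)

lemma Ath_scale: "a \<in> Ath \<Longrightarrow> (\<lambda>x. c * a x) \<in> Ath"
  by (simp add: Ath_iff Z2.decays_scale)

lemma Ath_uminus [intro, simp]: "a \<in> Ath \<Longrightarrow> - a \<in> Ath"
  using Ath_scale[of a "-1"] by (simp add: fun_Compl_def)

lemma Ath_diff [intro, simp]: "a \<in> Ath \<Longrightarrow> b \<in> Ath \<Longrightarrow> a - b \<in> Ath"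
  using Ath_add[of a "- b"] by simp

lemma Ath_finite_support: "finite {x. a x \<noteq> 0} \<Longrightarrow> a \<in> Ath"
  by (simp add: Ath_iff Z2.decays_finite_support)

lemma Ath_0 [intro, simp]: "0 \<in> Ath"
  by (rule Ath_finite_support) simp

lemma Ath_cstA [intro, simp]: "cstA c \<in> Ath"
  by (rule Ath_finite_support) (simp add: cstA_def)

lemma Ath_sum [intro]: "(\<And>i. i \<in> I \<Longrightarrow> f i \<in> Ath) \<Longrightarrow> sum f I \<in> Ath"
  by (induction I rule: infinite_finite_induct) auto

lemma Ath_reflect: "a \<in> Ath \<Longrightarrow> (\<And>x. norm (l x) \<le> 1) \<Longrightarrow> (\<lambda>x. l x * a (- x)) \<in> Ath"
proof -
  assume a: "a \<in> Ath" and l: "\<And>x. norm (l x) \<le> 1"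
  have "Z2.decays (\<lambda>x. a (- x))"
    using a unfolding Ath_iff Z2.decays_def by (metis wt_minus)
  then show ?thesis
    unfolding Ath_iff by (rule Z2.decays_poly_mult[where c = 1 and N = 0]) (use l in simp)
qed

lemma Ath_deltaA [intro, simp]: "a \<in> Ath \<Longrightarrow> deltaA \<tau> a \<in> Ath"
proof -
  assume a: "a \<in> Ath"
  have "norm (2 * of_real pi * \<i> * (of_int m * \<tau> + of_int n)) \<le> (2 * pi * (norm \<tau> + 1)) * wt (m, n) ^ 1" for m n
  proof -
    have "norm (of_int m * \<tau> + of_int n) \<le> \<bar>of_int m\<bar> * norm \<tau> + \<bar>of_int n\<bar>"
      using norm_triangle_ineq[of "of_int m * \<tau>" "of_int n"] by (simp add: norm_mult)
    also have "\<dots> \<le> wt (m, n) * norm \<tau> + wt (m, n)"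
      by (intro add_mono mult_right_mono) (auto simp: wt_def)
    finally have *: "norm (of_int m * \<tau> + of_int n) \<le> wt (m, n) * norm \<tau> + wt (m, n)" .
    have "norm (2 * of_real pi * \<i> * (of_int m * \<tau> + of_int n)) = 2 * pi * norm (of_int m * \<tau> + of_int n)"
      by (simp only: norm_mult) simp
    also have "\<dots> \<le> 2 * pi * (wt (m, n) * norm \<tau> + wt (m, n))" using * by (intro mult_left_mono) auto
    finally show ?thesis by (simp add: algebra_simps)
  qed
  then have "norm (2 * of_real pi * \<i> * (of_int (fst x) * \<tau> + of_int (snd x))) \<le> (2 * pi * (norm \<tau> + 1)) * wt x ^ 1" for x
    by (cases x) (simp only: fst_conv snd_conv)
  from Z2.decays_poly_mult[OF a[unfolded Ath_iff] this]
  show ?thesis unfolding Ath_iff deltaA_def by (simp add: case_prod_unfold)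
qed

lemma mulA_summable:
  assumes "a \<in> Ath" "b \<in> Ath"
  shows "(\<lambda>x. norm (a x * b (z - x) * tw \<theta> x (z - x))) summable_on UNIV"
proof -
  obtain B where B: "\<And>y. norm (b y) \<le> B" using Z2.decays_bounded assms(2) Ath_iff by metis
  have a: "(\<lambda>x. norm (a x)) summable_on UNIV" using assms(1) Ath_iff Z2.decays_abs_summable by blast
  show ?thesis
    by (rule summable_on_comparison_test[OF summable_on_cmult_left[OF a, of B]])
      (auto simp: norm_mult B intro!: mult_left_mono)
qed

text \<open>The weight \<open>wt z ^ k\<close> is distributed over \<open>x\<close> and
  \<open>z - x\<close>: \<open>a\<close> times its share is still summable, \<open>b\<close> times
  its share still bounded.\<close>

lemma Ath_mulA [intro, simp]:
  assumes "a \<in> Ath" "b \<in> Ath"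
  shows "mulA \<theta> a b \<in> Ath"
  unfolding Ath_iff Z2.decays_def
proof
  fix k
  obtain B where B: "\<And>y. norm (b y) * wt y ^ k \<le> B"
    using assms(2) unfolding Ath_iff Z2.decays_def by metis
  have "Z2.decays (\<lambda>x. complex_of_real (wt x ^ k) * a x)"
    using assms(1) by (intro Z2.decays_poly_mult[where c = 1 and N = k]) (auto simp: Ath_iff norm_power)
  from Z2.decays_abs_summable[OF this]
  have ak: "(\<lambda>x. norm (a x) * wt x ^ k) summable_on UNIV" by (simp add: norm_mult norm_power mult.commute)
  have "norm (mulA \<theta> a b z) * wt z ^ k \<le> (\<Sum>\<^sub>\<infinity>x. norm (a x) * wt x ^ k) * B" for z
  proof -
    have "norm (mulA \<theta> a b z) * wt z ^ k
        \<le> (\<Sum>\<^sub>\<infinity>x. norm (a x * b (z - x) * tw \<theta> x (z - x))) * wt z ^ k"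
      unfolding mulA_conv by (intro mult_right_mono norm_infsum_bound mulA_summable assms) auto
    also have "\<dots> = (\<Sum>\<^sub>\<infinity>x. norm (a x * b (z - x) * tw \<theta> x (z - x)) * wt z ^ k)"
      by (rule infsum_cmult_left'[symmetric])
    also have "\<dots> \<le> (\<Sum>\<^sub>\<infinity>x. norm (a x) * wt x ^ k * B)"
    proof (intro infsum_mono summable_on_cmult_left mulA_summable assms ak)
      fix x
      have "wt z ^ k \<le> (wt x * wt (z - x)) ^ k" using wt_add[of x "z - x"] by (intro power_mono) auto
      then have "norm (a x * b (z - x) * tw \<theta> x (z - x)) * wt z ^ k
          \<le> norm (a x * b (z - x) * tw \<theta> x (z - x)) * (wt x * wt (z - x)) ^ k"
        by (intro mult_left_mono) auto
      also have "\<dots> = norm (a x) * wt x ^ k * (norm (b (z - x)) * wt (z - x) ^ k)"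
        by (simp add: norm_mult power_mult_distrib)
      also have "\<dots> \<le> norm (a x) * wt x ^ k * B" by (intro mult_left_mono B) auto
      finally show "norm (a x * b (z - x) * tw \<theta> x (z - x)) * wt z ^ k \<le> norm (a x) * wt x ^ k * B" .
    qed
    also have "\<dots> = (\<Sum>\<^sub>\<infinity>x. norm (a x) * wt x ^ k) * B" by (rule infsum_cmult_left')
    finally show ?thesis .
  qed
  then show "\<exists>C. \<forall>z. norm (mulA \<theta> a b z) * wt z ^ k \<le> C" by blast
qed

lemma mulA_add_left:
  assumes "a \<in> Ath" "b \<in> Ath" "c \<in> Ath"
  shows "mulA \<theta> (a + b) c = mulA \<theta> a c + mulA \<theta> b c"
proof
  fix z
  show "mulA \<theta> (a + b) c z = (mulA \<theta> a c + mulA \<theta> b c) z"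
    using assms by (simp add: mulA_conv distrib_right infsum_add abs_summable_summable mulA_summable)
qed

lemma mulA_add_right:
  assumes "a \<in> Ath" "b \<in> Ath" "c \<in> Ath"
  shows "mulA \<theta> a (b + c) = mulA \<theta> a b + mulA \<theta> a c"
proof
  fix z
  show "mulA \<theta> a (b + c) z = (mulA \<theta> a b + mulA \<theta> a c) z"
    using assms
    by (simp add: mulA_conv distrib_right distrib_left infsum_add abs_summable_summable mulA_summable)
qed

lemma mulA_scale_left: "mulA \<theta> (\<lambda>x. c * a x) b = (\<lambda>x. c * mulA \<theta> a b x)"
  by (simp add: fun_eq_iff mulA_conv infsum_cmult_right'[symmetric] mult_ac)

lemma mulA_0 [simp]: "mulA \<theta> 0 b = 0" "mulA \<theta> a 0 = 0"
  by (simp_all add: fun_eq_iff mulA_conv)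

lemma mulA_cstA: "mulA \<theta> (cstA c) a = (\<lambda>x. c * a x)" "mulA \<theta> a (cstA c) = (\<lambda>x. c * a x)"
proof -
  have "mulA \<theta> (cstA c) a z = infsum (\<lambda>x. cstA c x * a (z - x) * tw \<theta> x (z - x)) {0}" for z
    unfolding mulA_conv by (rule infsum_cong_neutral) (auto simp: cstA_def zero_prod_def)
  then show "mulA \<theta> (cstA c) a = (\<lambda>x. c * a x)" by (auto simp: cstA_def zero_prod_def fun_eq_iff tw_def)
  have "mulA \<theta> a (cstA c) z = infsum (\<lambda>x. a x * cstA c (z - x) * tw \<theta> x (z - x)) {z}" for z
    unfolding mulA_conv by (rule infsum_cong_neutral) (auto simp: cstA_def prod_eq_iff)
  then show "mulA \<theta> a (cstA c) = (\<lambda>x. c * a x)" by (auto simp: cstA_def fun_eq_iff zero_prod_def[symmetric])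
qed

lemma mulA_assoc:
  assumes "a \<in> Ath" "b \<in> Ath" "c \<in> Ath"
  shows "mulA \<theta> (mulA \<theta> a b) c = mulA \<theta> a (mulA \<theta> b c)"
proof
  fix z
  have b: "(\<lambda>y. norm (b y)) summable_on UNIV" and a: "(\<lambda>y. norm (a y)) summable_on UNIV"
    using assms Ath_iff Z2.decays_abs_summable by blast+
  obtain C where C: "\<And>y. norm (c y) \<le> C" using Z2.decays_bounded assms(3) Ath_iff by metis
  have shift: "bij_betw (\<lambda>y. y + x) UNIV UNIV" for x :: "int \<times> int"
    by (rule bij_betw_byWitness[where f' = "\<lambda>y. y - x"]) auto
  \<comment> \<open>Here \<open>y\<close> is the total degree of the first two factors, so the left
    bracketing is a kernel composed on the right with \<open>c\<close>.\<close>
  let ?K = "\<lambda>x y. b (y - x) * tw \<theta> x (y - x)"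
  have K: "(\<lambda>y. norm (?K x y)) summable_on UNIV" "(\<Sum>\<^sub>\<infinity>y. norm (?K x y)) \<le> (\<Sum>\<^sub>\<infinity>y. norm (b y))" for x
  proof -
    show "(\<lambda>y. norm (?K x y)) summable_on UNIV"
      by (subst summable_on_reindex_bij_betw[OF shift[of x], symmetric]) (simp add: norm_mult b)
    show "(\<Sum>\<^sub>\<infinity>y. norm (?K x y)) \<le> (\<Sum>\<^sub>\<infinity>y. norm (b y))"
      by (subst infsum_reindex_bij_betw[OF shift[of x], symmetric]) (simp add: norm_mult)
  qed
  have "mulA \<theta> (mulA \<theta> a b) c z
      = (\<Sum>\<^sub>\<infinity>y. (\<Sum>\<^sub>\<infinity>x. a x * ?K x y) * (c (z - y) * tw \<theta> y (z - y)))"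
    by (simp add: mulA_conv mult_ac)
  also have "\<dots> = (\<Sum>\<^sub>\<infinity>x. a x * (\<Sum>\<^sub>\<infinity>y. ?K x y * (c (z - y) * tw \<theta> y (z - y))))"
    by (rule infsum_swap_kernel[OF a K, symmetric, where V = C]) (simp add: norm_mult C)
  also have "\<dots> = (\<Sum>\<^sub>\<infinity>x. a x * (mulA \<theta> b c (z - x) * tw \<theta> x (z - x)))"
  proof (intro infsum_cong arg_cong[of _ _ "\<lambda>u. _ * u"])
    fix x
    have s: "z - (y + x) = z - x - y" for y by (simp add: algebra_simps)
    \<comment> \<open>The cocycle identity. It holds because \<open>tw\<close> is multiplicative in
      each argument: both sides contain one phase for each pair among the degrees \<open>x\<close>,
      \<open>y\<close>, \<open>z - x - y\<close>.\<close>
    have ph: "tw \<theta> x y * tw \<theta> (y + x) (z - x - y) = tw \<theta> y (z - x - y) * tw \<theta> x (z - x)" for y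
    proof -
      have "tw \<theta> x (z - x) = tw \<theta> x y * tw \<theta> x (z - x - y)" using tw_add_right[of \<theta> x y "z - x - y"] by simp
      then show ?thesis by (simp only: tw_add_left mult_ac)
    qed
    have e: "b y * tw \<theta> x y * (c (z - (y + x)) * tw \<theta> (y + x) (z - (y + x)))
      = b y * c (z - x - y) * tw \<theta> y (z - x - y) * tw \<theta> x (z - x)" for y
      using arg_cong[OF ph[of y], of "\<lambda>u. b y * c (z - x - y) * u"] by (simp only: s mult_ac)
    have "(\<Sum>\<^sub>\<infinity>y. ?K x y * (c (z - y) * tw \<theta> y (z - y)))
      = (\<Sum>\<^sub>\<infinity>y. b y * tw \<theta> x y * (c (z - (y + x)) * tw \<theta> (y + x) (z - (y + x))))"
      by (subst infsum_reindex_bij_betw[OF shift[of x], symmetric]) simp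
    also have "\<dots> = mulA \<theta> b c (z - x) * tw \<theta> x (z - x)"
      unfolding e mulA_conv by (rule infsum_cmult_left')
    finally show "(\<Sum>\<^sub>\<infinity>y. ?K x y * (c (z - y) * tw \<theta> y (z - y))) = mulA \<theta> b c (z - x) * tw \<theta> x (z - x)" .
  qed
  also have "\<dots> = mulA \<theta> a (mulA \<theta> b c) z"
    by (simp add: mulA_conv[of \<theta> a] mult_ac)
  finally show "mulA \<theta> (mulA \<theta> a b) c z = mulA \<theta> a (mulA \<theta> b c) z" .
qed

lemma deltaA_conv:
  "deltaA \<tau> a x = 2 * of_real pi * \<i> * (of_int (fst x) * \<tau> + of_int (snd x)) * a x"
  by (cases x) (simp add: deltaA_def)

lemma deltaA_add: "deltaA \<tau> (a + b) = deltaA \<tau> a + deltaA \<tau> b"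
  by (simp add: fun_eq_iff deltaA_conv algebra_simps)

lemma deltaA_0 [simp]: "deltaA \<tau> 0 = 0"
  by (simp add: fun_eq_iff deltaA_conv)

lemma trA_deltaA [simp]: "trA (deltaA \<tau> a) = 0"
  by (simp add: trA_def deltaA_conv)

lemma trA_add: "trA (a + b) = trA a + trA b" and trA_diff: "trA (a - b) = trA a - trA b"
  and trA_0 [simp]: "trA 0 = 0"
  by (simp_all add: trA_def)

lemma sum_fun_apply: "sum f I x = (\<Sum>i\<in>I. f i x)"
  by (induction I rule: infinite_finite_induct) auto

lemma trA_sum: "trA (sum f I) = (\<Sum>i\<in>I. trA (f i))"
  by (simp add: trA_def sum_fun_apply)

text \<open>The symbol of \<open>deltaA\<close> is additive in the degree, and
  \<open>z = x + (z - x)\<close> in every term of the product.\<close>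

lemma deltaA_mulA:
  assumes "a \<in> Ath" "b \<in> Ath"
  shows "deltaA \<tau> (mulA \<theta> a b) = mulA \<theta> (deltaA \<tau> a) b + mulA \<theta> a (deltaA \<tau> b)"
proof
  fix z
  have "deltaA \<tau> (mulA \<theta> a b) z = (\<Sum>\<^sub>\<infinity>x. 2 * of_real pi * \<i> * (of_int (fst z) * \<tau> + of_int (snd z))
      * (a x * b (z - x) * tw \<theta> x (z - x)))"
    unfolding deltaA_conv mulA_conv by (rule infsum_cmult_right'[symmetric])
  also have "\<dots> = (\<Sum>\<^sub>\<infinity>x. deltaA \<tau> a x * b (z - x) * tw \<theta> x (z - x)
      + a x * deltaA \<tau> b (z - x) * tw \<theta> x (z - x))"
    by (intro infsum_cong) (simp add: deltaA_conv algebra_simps)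
  also have "\<dots> = (mulA \<theta> (deltaA \<tau> a) b + mulA \<theta> a (deltaA \<tau> b)) z"
    using assms by (simp add: mulA_conv infsum_add abs_summable_summable mulA_summable)
  finally show "deltaA \<tau> (mulA \<theta> a b) z = (mulA \<theta> (deltaA \<tau> a) b + mulA \<theta> a (deltaA \<tau> b)) z" .
qed

text \<open>Turns the trace pairing \<open>tr (a b)\<close> into the bilinear pairing of coefficient families.\<close>

definition twisted_reflect :: "real \<Rightarrow> coeffs \<Rightarrow> coeffs" where
  "twisted_reflect \<theta> a x = a (- x) * tw \<theta> (- x) x"

definition twisted_reflect_inv :: "real \<Rightarrow> coeffs \<Rightarrow> coeffs" where
  "twisted_reflect_inv \<theta> u x = u (- x) / tw \<theta> x (- x)"

lemma twisted_reflect_reflect_inv: "twisted_reflect \<theta> (twisted_reflect_inv \<theta> u) = u" and twisted_reflect_inv_reflect: "twisted_reflect_inv \<theta> (twisted_reflect \<theta> u) = u"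
  by (simp_all add: twisted_reflect_def twisted_reflect_inv_def fun_eq_iff)

lemma Ath_twisted_reflect: "a \<in> Ath \<Longrightarrow> twisted_reflect \<theta> a \<in> Ath" and Ath_twisted_reflect_inv: "a \<in> Ath \<Longrightarrow> twisted_reflect_inv \<theta> a \<in> Ath"
  using Ath_reflect[of a "\<lambda>x. tw \<theta> (- x) x"] Ath_reflect[of a "\<lambda>x. 1 / tw \<theta> x (- x)"]
  by (simp_all add: twisted_reflect_def[abs_def] twisted_reflect_inv_def[abs_def] mult.commute norm_divide)

lemma trA_mulA_has_sum:
  assumes "a \<in> Ath" "b \<in> Ath"
  shows "((\<lambda>y. twisted_reflect \<theta> a y * b y) has_sum trA (mulA \<theta> a b)) UNIV"
proof -
  have "((\<lambda>x. a x * b (0 - x) * tw \<theta> x (0 - x)) has_sum trA (mulA \<theta> a b)) UNIV"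
    unfolding trA_def mulA_conv zero_prod_def[symmetric]
    by (rule has_sum_infsum[OF abs_summable_summable[OF mulA_summable[OF assms]]])
  moreover have "bij_betw uminus UNIV (UNIV :: (int \<times> int) set)"
    by (rule bij_betw_byWitness[where f' = uminus]) auto
  ultimately show ?thesis
    by (subst (asm) has_sum_reindex_bij_betw[symmetric]) (auto simp: twisted_reflect_def mult_ac)
qed

lemma trA_nondegenerate_left:
  assumes a: "a \<in> Ath" and z: "\<And>b. b \<in> Ath \<Longrightarrow> trA (mulA \<theta> a b) = 0"
  shows "a = 0"
proof
  fix x
  \<comment> \<open>The monomial \<open>U^(-x)\<close>: the trace of \<open>a\<close> times it is
    the coefficient of \<open>a\<close> at \<open>x\<close> up to a phase.\<close>
  define e :: coeffs where "e y = (if y = - x then 1 else 0)" for y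
  have e: "e \<in> Ath" by (rule Ath_finite_support) (simp add: e_def)
  have "((\<lambda>y. twisted_reflect \<theta> a y * e y) has_sum 0) UNIV" using trA_mulA_has_sum[OF a e, of \<theta>] z[OF e] by simp
  moreover have "((\<lambda>y. twisted_reflect \<theta> a y * e y) has_sum twisted_reflect \<theta> a (- x)) UNIV"
    by (rule has_sum_finite_neutralI[of "{- x}"]) (auto simp: e_def)
  ultimately have "twisted_reflect \<theta> a (- x) = 0" by (metis has_sum_unique)
  then show "a x = 0 x" by (simp add: twisted_reflect_def)
qed

lemma trA_nondegenerate_right:
  assumes a: "a \<in> Ath" and z: "\<And>b. b \<in> Ath \<Longrightarrow> trA (mulA \<theta> b a) = 0"
  shows "a = 0"
proof
  fix x
  define e :: coeffs where "e y = (if y = x then 1 else 0)" for y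
  \<comment> \<open>Again a multiple of \<open>U^(-x)\<close>, with the phase that makes the trace
    equal to \<open>a x\<close> exactly.\<close>
  have e: "twisted_reflect_inv \<theta> e \<in> Ath" by (intro Ath_twisted_reflect_inv Ath_finite_support) (simp add: e_def)
  have "((\<lambda>y. e y * a y) has_sum 0) UNIV"
    using trA_mulA_has_sum[OF e a, of \<theta>] z[OF e] by (simp add: twisted_reflect_reflect_inv)
  moreover have "((\<lambda>y. e y * a y) has_sum a x) UNIV"
    by (rule has_sum_finite_neutralI[of "{x}"]) (auto simp: e_def)
  ultimately show "a x = 0 x" by (metis has_sum_unique zero_fun_apply)
qed

section \<open>Vectors over the noncommutative torus\<close>

text \<open>The row index enters the weight so that sublevel sets stay finite although there are
  infinitely many rows.\<close>

definition vwt :: "nat \<times> int \<times> int \<Rightarrow> real" where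
  "vwt p = wt (snd p) + real (fst p)"

lemma vwt_ge_wt: "wt z \<le> vwt (i, z)" and vwt_ge_1: "1 \<le> vwt p" and vwt_pos [simp]: "0 < vwt p" "0 \<le> vwt p"
  using wt_ge_1[of "snd p"] by (simp_all add: vwt_def del: wt_ge_1)

lemma finite_vwt_sublevel: "finite {p. vwt p \<le> r}"
proof (rule finite_subset)
  show "{p. vwt p \<le> r} \<subseteq> {..nat \<lceil>r\<rceil>} \<times> {z. wt z \<le> r}"
  proof
    fix p assume "p \<in> {p. vwt p \<le> r}"
    then have *: "wt (snd p) + real (fst p) \<le> r" by (simp add: vwt_def)
    then have "wt (snd p) \<le> r" "real (fst p) \<le> r" using wt_pos(1)[of "snd p"] by linarith+
    moreover from this(2) have "fst p \<le> nat \<lceil>r\<rceil>" by linarith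
    ultimately show "p \<in> {..nat \<lceil>r\<rceil>} \<times> {z. wt z \<le> r}" by (cases p) simp
  qed
qed (auto intro: finite_wt_sublevel)

lemma summable_on_vwt: "(\<lambda>p. 1 / vwt p ^ 6) summable_on UNIV"
proof -
  define q where "q i = 1 / (1 + real i) ^ 2" for i
  have "(\<lambda>p. q (fst p) * (1 / wt (snd p) ^ 4)) summable_on UNIV"
    using summable_on_nat_inverse_square summable_on_wt
    by (intro summable_on_prod_mult) (auto simp: q_def[abs_def])
  moreover have "1 / vwt p ^ 6 \<le> q (fst p) * (1 / wt (snd p) ^ 4)" for p
  proof -
    obtain i z where p: "p = (i, z)" by (cases p)
    have "(1 + real i) ^ 2 * wt z ^ 4 \<le> vwt p ^ 2 * vwt p ^ 4"
      using wt_ge_1[of z] by (intro mult_mono power_mono) (auto simp: vwt_def p)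
    also have "\<dots> = vwt p ^ 6" by (simp flip: power_add)
    finally have "1 / vwt p ^ 6 \<le> 1 / ((1 + real i) ^ 2 * wt z ^ 4)"
      by (intro divide_left_mono mult_pos_pos zero_less_power) auto
    then show ?thesis by (simp add: p q_def)
  qed
  ultimately show ?thesis
    by (rule summable_on_comparison_test) simp
qed

interpretation Z2n: weighted_index vwt
  by (rule weighted_index.intro) (rule vwt_ge_1, rule finite_vwt_sublevel, rule exI[of _ 6], rule summable_on_vwt)

section \<open>Column vectors as families, matrices as kernels\<close>

definition flatten :: "(nat \<Rightarrow> coeffs) \<Rightarrow> nat \<times> int \<times> int \<Rightarrow> complex" where
  "flatten v p = v (fst p) (snd p)"

text \<open>The cut-off discards rows beyond the rank, which a general family may have. Thus
  \<open>columns n\<close> inverts \<open>flatten\<close> on \<open>freeA n\<close> from one side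
  only.\<close>

definition columns :: "nat \<Rightarrow> (nat \<times> int \<times> int \<Rightarrow> complex) \<Rightarrow> nat \<Rightarrow> coeffs" where
  "columns n V i = (if i < n then (\<lambda>z. V (i, z)) else 0)"

lemma freeA_iff: "v \<in> freeA n \<longleftrightarrow> (\<forall>i. v i \<in> Ath) \<and> (\<forall>i\<ge>n. v i = 0)"
  by (simp add: freeA_def zeroA_eq)

lemma freeA_D: "v \<in> freeA n \<Longrightarrow> v i \<in> Ath" "v \<in> freeA n \<Longrightarrow> n \<le> i \<Longrightarrow> v i = 0"
  by (simp_all add: freeA_iff)

lemma freeA_add [simp]: "v \<in> freeA n \<Longrightarrow> w \<in> freeA n \<Longrightarrow> v + w \<in> freeA n"
  and freeA_diff [simp]: "v \<in> freeA n \<Longrightarrow> w \<in> freeA n \<Longrightarrow> v - w \<in> freeA n"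
  and freeA_0 [simp]: "0 \<in> freeA n"
  by (simp_all add: freeA_iff)

lemma decays_slice:
  assumes "Z2n.decays V"
  shows "(\<lambda>z. V (i, z)) \<in> Ath"
  unfolding Ath_iff Z2.decays_def
proof
  fix k
  obtain C where C: "\<And>p. norm (V p) * vwt p ^ k \<le> C" using assms unfolding Z2n.decays_def by metis
  have "norm (V (i, z)) * wt z ^ k \<le> C" for z
    using mult_left_mono[OF power_mono[OF vwt_ge_wt[of z i], of k], of "norm (V (i, z))"] C[of "(i, z)"]
    by simp
  then show "\<exists>C. \<forall>z. norm (V (i, z)) * wt z ^ k \<le> C" by blast
qed

lemma columns_freeA: "Z2n.decays V \<Longrightarrow> columns n V \<in> freeA n"
  by (auto simp: freeA_iff columns_def decays_slice)

lemma decays_flatten: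
  assumes "v \<in> freeA n"
  shows "Z2n.decays (flatten v)"
  unfolding Z2n.decays_def
proof
  fix k
  have "\<exists>C. \<forall>z. norm (v i z) * wt z ^ k \<le> C" for i
    using freeA_D(1)[OF assms] unfolding Ath_iff Z2.decays_def by blast
  then obtain C where C: "\<And>i z. norm (v i z) * wt z ^ k \<le> C i" by metis
  have C0: "0 \<le> C i" for i using C[of i 0] by (smt (verit) mult_nonneg_nonneg norm_ge_zero wt_pos(2) zero_le_power)
  have "norm (flatten v p) * vwt p ^ k \<le> (1 + real n) ^ k * sum C {..<n}" for p
  proof -
    obtain i z where p: "p = (i, z)" by (cases p)
    show ?thesis
    proof (cases "i < n")
      case True
      have "real i \<le> real n * wt z" using True mult_mono[of "real i" "real n" 1 "wt z"] by simp
      then have "vwt p ^ k \<le> ((1 + real n) * wt z) ^ k"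
        by (intro power_mono) (auto simp: vwt_def p algebra_simps)
      then have "norm (flatten v p) * vwt p ^ k \<le> norm (v i z) * ((1 + real n) * wt z) ^ k"
        by (simp add: flatten_def p mult_left_mono)
      also have "\<dots> = (1 + real n) ^ k * (norm (v i z) * wt z ^ k)" by (simp add: power_mult_distrib)
      also have "\<dots> \<le> (1 + real n) ^ k * C i" by (intro mult_left_mono C) auto
      also have "\<dots> \<le> (1 + real n) ^ k * sum C {..<n}"
        using True C0 by (intro mult_left_mono member_le_sum) auto
      finally show ?thesis .
    next
      case False
      then show ?thesis using freeA_D(2)[OF assms, of i] C0 by (simp add: flatten_def p sum_nonneg)
    qed
  qed
  then show "\<exists>C. \<forall>p. norm (flatten v p) * vwt p ^ k \<le> C" by blast
qed

lemma columns_flatten [simp]: "v \<in> freeA n \<Longrightarrow> columns n (flatten v) = v"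
  by (auto simp: fun_eq_iff columns_def flatten_def freeA_iff)

lemma columns_add: "columns n (\<lambda>p. U p + V p) = columns n U + columns n V"
  and columns_scale: "columns n (\<lambda>p. c * V p) = (\<lambda>i z. c * columns n V i z)"
  by (auto simp: fun_eq_iff columns_def)

text \<open>On the first \<open>n\<close> rows
  \<open>vwt p \<le> (1 + n) * wt (z - y) * vwt q\<close>, so the quotient of the weights is
  absorbed by \<open>k\<close>, all of whose moments are summable. Assuming only a majorant lets the
  lemma cover a matrix kernel and its transpose.\<close>

lemma tame_convolution_bound:
  assumes b: "\<And>i z j y. norm (L (i, z) (j, y)) \<le> (if i < n \<and> j < n then k (z - y) else 0)"
    and k: "\<And>N. (\<lambda>x. k x * wt x ^ N) summable_on UNIV"
  shows "Z2n.tame L"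
  unfolding Z2n.tame_def
proof
  fix N :: nat
  have shift: "bij_betw (\<lambda>y. z - y) UNIV UNIV" for z :: "int \<times> int"
    by (rule bij_betw_byWitness[where f' = "\<lambda>y. z - y"]) auto
  define S where "S = (\<Sum>\<^sub>\<infinity>x. k x * wt x ^ N)"
  have main: "(\<lambda>q. norm (L p q) / vwt q ^ N) summable_on UNIV \<and>
     (\<Sum>\<^sub>\<infinity>q. norm (L p q) / vwt q ^ N) * vwt p ^ N \<le> (1 + real n) ^ N * (real n * S)" for p
  proof -
    obtain i z where p: "p = (i, z)" by (cases p)
    define h where "h q = (if fst q < n then k (z - snd q) * wt (z - snd q) ^ N else 0)" for q :: "nat \<times> int \<times> int"
    have "((\<lambda>y. k (z - y) * wt (z - y) ^ N) has_sum S) UNIV"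
      unfolding S_def using has_sum_infsum[OF k[of N]]
      by (subst has_sum_reindex_bij_betw[OF shift[of z], where f = "\<lambda>x. k x * wt x ^ N"])
    then have h: "(h has_sum (\<Sum>j<n. S)) UNIV"
      by (intro has_sum_strip) (auto simp: h_def)
    have le: "norm (L p q) / vwt q ^ N * vwt p ^ N \<le> (1 + real n) ^ N * h q" for q
    proof -
      obtain j y where q: "q = (j, y)" by (cases q)
      show ?thesis
      proof (cases "i < n \<and> j < n")
        case False
        then have "norm (L p q) = 0" using b[of i z j y] by (simp add: p q split: if_splits)
        moreover have "0 \<le> h q"
        proof (cases "i < n")
          case True
          then show ?thesis using False by (simp add: h_def q)
        next
          case False
          \<comment> \<open>Nonnegativity of \<open>k\<close> is not a hypothesis; it follows from
            the bound on entries between rows of index 0, available once \<open>n\<close> is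
            positive.\<close>
          have "0 \<le> k x" if "0 < n" for x
            using b[of 0 x 0 0] that by (simp add: order_trans[OF norm_ge_zero])
          then show ?thesis by (auto simp: h_def)
        qed
        ultimately show ?thesis by simp
      next
        case True
        have "wt z \<le> wt (z - y) * wt y" using wt_add[of "z - y" y] by simp
        moreover have "real i \<le> real n * (wt (z - y) * wt y)"
          using True mult_mono[of 1 "wt (z - y)" 1 "wt y"] mult_mono[of "real i" "real n" 1 "wt (z - y) * wt y"] by simp
        ultimately have "vwt p \<le> (1 + real n) * (wt (z - y) * wt y)"
          by (simp add: vwt_def p algebra_simps)
        also have "\<dots> \<le> (1 + real n) * (wt (z - y) * vwt q)"
          by (intro mult_left_mono) (auto simp: q vwt_ge_wt)
        finally have "vwt p ^ N \<le> ((1 + real n) * (wt (z - y) * vwt q)) ^ N" by (intro power_mono) auto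
        then have "vwt p ^ N / vwt q ^ N \<le> (1 + real n) ^ N * wt (z - y) ^ N"
          by (simp add: power_mult_distrib pos_divide_le_eq mult_ac)
        then have "norm (L p q) * (vwt p ^ N / vwt q ^ N) \<le> k (z - y) * ((1 + real n) ^ N * wt (z - y) ^ N)"
          using b[of i z j y] order_trans[OF norm_ge_zero b[of i z j y]] True
          by (intro mult_mono) (auto simp: p q)
        then show ?thesis using True by (simp add: h_def q mult_ac)
      qed
    qed
    have Bp: "0 < vwt p ^ N" by simp
    have le': "norm (L p q) / vwt q ^ N \<le> h q * ((1 + real n) ^ N / vwt p ^ N)" for q
      using le[of q] Bp by (simp add: pos_le_divide_eq mult_ac)
    have hs: "(\<lambda>q. h q * ((1 + real n) ^ N / vwt p ^ N)) summable_on UNIV"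
      using h by (intro summable_on_cmult_left has_sum_imp_summable)
    have s: "(\<lambda>q. norm (L p q) / vwt q ^ N) summable_on UNIV"
      by (rule summable_on_comparison_test[OF hs]) (use le' in auto)
    have "(\<Sum>\<^sub>\<infinity>q. norm (L p q) / vwt q ^ N) \<le> (\<Sum>\<^sub>\<infinity>q. h q * ((1 + real n) ^ N / vwt p ^ N))"
      by (intro infsum_mono s hs le')
    also have "\<dots> = (real n * S) * ((1 + real n) ^ N / vwt p ^ N)"
      using h by (subst infsum_cmult_left') (simp add: infsumI)
    finally have "(\<Sum>\<^sub>\<infinity>q. norm (L p q) / vwt q ^ N) * vwt p ^ N \<le> (1 + real n) ^ N * (real n * S)"
      using Bp by (simp add: pos_le_divide_eq mult_ac)
    with s show ?thesis by blast
  qed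
  then show "\<exists>C. \<forall>p. (\<lambda>q. norm (L p q) / vwt q ^ N) summable_on UNIV \<and>
     (\<Sum>\<^sub>\<infinity>q. norm (L p q) / vwt q ^ N) * vwt p ^ N \<le> C" by blast
qed

text \<open>Left multiplication of columns by the matrix \<open>M\<close>; the factor
  \<open>tw \<theta> (z - y) y\<close> is the phase of \<open>U^(z-y) U^y\<close>.\<close>

definition conv_kernel :: "real \<Rightarrow> nat \<Rightarrow> (nat \<Rightarrow> nat \<Rightarrow> coeffs) \<Rightarrow> nat \<times> int \<times> int \<Rightarrow> nat \<times> int \<times> int \<Rightarrow> complex" where
  "conv_kernel \<theta> n M = (\<lambda>(i, z) (j, y). if i < n \<and> j < n then M i j (z - y) * tw \<theta> (z - y) y else 0)"

lemma summable_on_finite_sum: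
  fixes f :: "'a \<Rightarrow> 'b \<Rightarrow> real"
  assumes "finite I" "\<And>i. i \<in> I \<Longrightarrow> f i summable_on A"
  shows "(\<lambda>x. \<Sum>i\<in>I. f i x) summable_on A"
  using assms by (induction I rule: finite_induct) (auto intro!: summable_on_add)

lemma tame_conv_kernel:
  assumes M: "\<And>i j. M i j \<in> Ath"
  shows "Z2n.tame (conv_kernel \<theta> n M)" "Z2n.tame (\<lambda>p q. conv_kernel \<theta> n M q p)"
proof -
  define k where "k x = (\<Sum>i<n. \<Sum>j<n. norm (M i j x))" for x
  have k: "norm (M i j x) \<le> k x" if "i < n" "j < n" for i j x
  proof -
    have "norm (M i j x) \<le> (\<Sum>j<n. norm (M i j x))" using that by (intro member_le_sum) auto
    also have "\<dots> \<le> k x" unfolding k_def using that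
      by (intro member_le_sum[of i _ "\<lambda>i. \<Sum>j<n. norm (M i j x)"]) (auto intro: sum_nonneg)
    finally show ?thesis .
  qed
  have s: "(\<lambda>x. k x * wt x ^ N) summable_on UNIV" for N
  proof -
    have "(\<lambda>x. norm (M i j x) * wt x ^ N) summable_on UNIV" for i j
    proof -
      have "Z2.decays (\<lambda>x. complex_of_real (wt x ^ N) * M i j x)"
        using M by (intro Z2.decays_poly_mult[where c = 1 and N = N]) (auto simp: Ath_iff norm_power)
      from Z2.decays_abs_summable[OF this]
      show ?thesis by (simp add: norm_mult norm_power mult.commute)
    qed
    then show ?thesis unfolding k_def sum_distrib_right by (intro summable_on_finite_sum) auto
  qed
  show "Z2n.tame (conv_kernel \<theta> n M)"
    by (rule tame_convolution_bound[OF _ s]) (auto simp: conv_kernel_def norm_mult k)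
  \<comment> \<open>The transposed kernel depends on \<open>y - z\<close>, so its majorant is the
    reflection of \<open>k\<close>.\<close>
  have "(\<lambda>x. k (- x) * wt x ^ N) summable_on UNIV" for N
  proof -
    have "bij_betw uminus UNIV (UNIV :: (int \<times> int) set)"
      by (rule bij_betw_byWitness[where f' = uminus]) auto
    from summable_on_reindex_bij_betw[OF this, of "\<lambda>x. k x * wt x ^ N"] s[of N] show ?thesis by simp
  qed
  then show "Z2n.tame (\<lambda>p q. conv_kernel \<theta> n M q p)"
    by (rule tame_convolution_bound[rotated]) (auto simp: conv_kernel_def norm_mult k)
qed

lemma app_conv_kernel:
  assumes M: "\<And>i j. M i j \<in> Ath" and V: "Z2n.decays V"
  shows "Z2n.app (conv_kernel \<theta> n M) V (i, z) = (if i < n then (\<Sum>j<n. mulA \<theta> (M i j) (columns n V j)) z else 0)"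
proof (cases "i < n")
  case True
  have shift: "bij_betw (\<lambda>y. z - y) UNIV UNIV"
    by (rule bij_betw_byWitness[where f' = "\<lambda>y. z - y"]) auto
  have "((\<lambda>y. conv_kernel \<theta> n M (i, z) (j, y) * V (j, y)) has_sum mulA \<theta> (M i j) (columns n V j) z) UNIV"
    if j: "j < n" for j
  proof -
    have "(\<lambda>x. M i j x * columns n V j (z - x) * tw \<theta> x (z - x)) summable_on UNIV"
      by (rule abs_summable_summable[OF mulA_summable[OF M freeA_D(1)[OF columns_freeA[OF V]]]])
    from has_sum_infsum[OF this]
    have "((\<lambda>x. M i j x * columns n V j (z - x) * tw \<theta> x (z - x)) has_sum mulA \<theta> (M i j) (columns n V j) z) UNIV"
      by (simp add: mulA_conv)
    then show ?thesis
      using has_sum_reindex_bij_betw[OF shift, of "\<lambda>x. M i j x * columns n V j (z - x) * tw \<theta> x (z - x)"] True j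
      by (simp add: conv_kernel_def columns_def mult_ac)
  qed
  then have "((\<lambda>q. conv_kernel \<theta> n M (i, z) q * V q) has_sum (\<Sum>j<n. mulA \<theta> (M i j) (columns n V j) z)) UNIV"
    by (rule has_sum_strip) (auto simp: conv_kernel_def)
  then show ?thesis using True unfolding Z2n.app_def by (simp add: infsumI sum_fun_apply)
next
  case False
  then show ?thesis by (simp add: Z2n.app_def conv_kernel_def case_prod_unfold)
qed

text \<open>Families live on all of \<open>nat \<times> int \<times> int\<close> so that \<open>n\<close> need not be a type; on the superfluous
  indices \<open>i \<ge> n\<close> any elliptic diagonal would do.\<close>

definition delta_symbol :: "complex \<Rightarrow> nat \<Rightarrow> nat \<times> int \<times> int \<Rightarrow> complex" where
  "delta_symbol \<tau> n p = (if fst p < n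
     then 2 * of_real pi * \<i> * (of_int (fst (snd p)) * \<tau> + of_int (snd (snd p))) else of_real (vwt p))"

lemma norm_delta_symbol_le: "norm (delta_symbol \<tau> n p) \<le> (2 * pi * (norm \<tau> + 1) + 1) * vwt p ^ 1"
proof (cases "fst p < n")
  case True
  obtain i m k where p: "p = (i, m, k)" by (cases p)
  have "norm (of_int m * \<tau> + of_int k) \<le> \<bar>of_int m\<bar> * norm \<tau> + \<bar>of_int k\<bar>"
    using norm_triangle_ineq[of "of_int m * \<tau>" "of_int k"] by (simp add: norm_mult)
  also have "\<dots> \<le> vwt p * norm \<tau> + vwt p"
    by (intro add_mono mult_right_mono) (auto simp: wt_def p vwt_def)
  finally have *: "norm (of_int m * \<tau> + of_int k) \<le> vwt p * norm \<tau> + vwt p" .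
  have "norm (delta_symbol \<tau> n p) = 2 * pi * norm (of_int m * \<tau> + of_int k)"
    using True by (simp add: delta_symbol_def p norm_mult)
  also have "\<dots> \<le> 2 * pi * (vwt p * norm \<tau> + vwt p)" using * by (intro mult_left_mono) auto
  also have "\<dots> \<le> 2 * pi * (vwt p * norm \<tau> + vwt p) + vwt p" by simp
  finally show ?thesis by (simp add: algebra_simps)
next
  case False
  have "1 * vwt p \<le> (2 * pi * (norm \<tau> + 1) + 1) * vwt p" by (intro mult_right_mono) auto
  then show ?thesis using False by (simp add: delta_symbol_def)
qed

text \<open>The imaginary part of \<open>m * \<tau> + k\<close> is \<open>m * Im \<tau>\<close>,
  which bounds \<open>m\<close>; subtracting \<open>m * \<tau>\<close> then bounds \<open>k\<close>.
  The constant \<open>A\<close> is the sum of the two resulting bounds.\<close>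

lemma delta_symbol_elliptic:
  assumes "Im \<tau> \<noteq> 0"
  shows "\<exists>c>0. finite {p. norm (delta_symbol \<tau> n p) < c * vwt p}"
proof -
  define T where "T = \<bar>Im \<tau>\<bar>"
  have T: "0 < T" using assms by (simp add: T_def)
  define A where "A = 1 / T + 1 + norm \<tau> / T"
  have A: "1 \<le> A" using T by (simp add: A_def)
  have lower: "\<bar>real_of_int m\<bar> + \<bar>real_of_int k\<bar> \<le> A * norm (of_int m * \<tau> + of_int k)" for m k
  proof -
    let ?N = "norm (of_int m * \<tau> + of_int k)"
    have "\<bar>real_of_int m\<bar> * T \<le> ?N"
      using abs_Im_le_cmod[of "of_int m * \<tau> + of_int k"] by (simp add: T_def abs_mult)
    then have m: "\<bar>real_of_int m\<bar> \<le> ?N / T" using T by (simp add: pos_le_divide_eq)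
    have "\<bar>real_of_int k\<bar> = norm ((of_int m * \<tau> + of_int k) - of_int m * \<tau>)" by simp
    also have "\<dots> \<le> ?N + norm (of_int m * \<tau>)" by (rule norm_triangle_ineq4)
    also have "norm (of_int m * \<tau>) = \<bar>real_of_int m\<bar> * norm \<tau>" by (simp add: norm_mult)
    also have "\<dots> \<le> ?N / T * norm \<tau>" by (intro mult_right_mono m) auto
    finally show ?thesis using m by (simp add: A_def algebra_simps)
  qed
  \<comment> \<open>Where the desired bound fails in a row \<open>i < n\<close>, this choice gives
    \<open>M \<le> vwt / 2\<close>, and since \<open>vwt = 1 + M + i\<close> the weight is at most
    \<open>2 * n + 2\<close>. In the remaining rows \<open>c \<le> 1/2\<close> excludes
    failure.\<close>
  define c where "c = 1 / (2 * A)"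
  have c: "0 < c" "c \<le> 1 / 2" using A by (simp_all add: c_def)
  have "{p. norm (delta_symbol \<tau> n p) < c * vwt p} \<subseteq> {p. vwt p \<le> 2 * real n + 2}"
  proof safe
    fix i m k assume a: "norm (delta_symbol \<tau> n (i, m, k)) < c * vwt (i, m, k)"
    define M where "M = \<bar>real_of_int m\<bar> + \<bar>real_of_int k\<bar>"
    have vwt: "vwt (i, m, k) = 1 + M + real i" by (simp add: vwt_def wt_def M_def)
    show "vwt (i, m, k) \<le> 2 * real n + 2"
    proof (cases "i < n")
      case True
      have "M \<le> A * norm (of_int m * \<tau> + of_int k)" using lower by (simp add: M_def)
      also have "\<dots> \<le> A * norm (delta_symbol \<tau> n (i, m, k))"
      proof (intro mult_left_mono)
        have "norm (delta_symbol \<tau> n (i, m, k)) = 2 * pi * norm (of_int m * \<tau> + of_int k)"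
          using True by (simp add: delta_symbol_def norm_mult)
        moreover have "1 * norm (of_int m * \<tau> + of_int k) \<le> 2 * pi * norm (of_int m * \<tau> + of_int k)"
          using pi_gt3 by (intro mult_right_mono) auto
        ultimately show "norm (of_int m * \<tau> + of_int k) \<le> norm (delta_symbol \<tau> n (i, m, k))" by simp
      qed (use A in auto)
      also have "\<dots> \<le> A * (c * vwt (i, m, k))" using a A by (intro mult_left_mono) auto
      also have "\<dots> = vwt (i, m, k) / 2" using A by (simp add: c_def)
      finally show ?thesis using True vwt by simp
    next
      case False
      then have "vwt (i, m, k) < c * vwt (i, m, k)" using a by (simp add: delta_symbol_def)
      moreover have "c * vwt (i, m, k) \<le> 1 / 2 * vwt (i, m, k)" by (intro mult_right_mono c) auto
      ultimately show ?thesis using vwt_pos(1)[of "(i, m, k)"] by linarith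
    qed
  qed
  then show ?thesis using c(1) finite_subset[OF _ finite_vwt_sublevel] by blast
qed

section \<open>Free modules and the pairing of rows with columns\<close>

definition vmul :: "real \<Rightarrow> (nat \<Rightarrow> coeffs) \<Rightarrow> coeffs \<Rightarrow> nat \<Rightarrow> coeffs" where
  "vmul \<theta> v a = (\<lambda>i. mulA \<theta> (v i) a)"

definition vdelta :: "complex \<Rightarrow> (nat \<Rightarrow> coeffs) \<Rightarrow> nat \<Rightarrow> coeffs" where
  "vdelta \<tau> v = (\<lambda>i. deltaA \<tau> (v i))"

definition dot :: "real \<Rightarrow> nat \<Rightarrow> (nat \<Rightarrow> coeffs) \<Rightarrow> (nat \<Rightarrow> coeffs) \<Rightarrow> coeffs" where
  "dot \<theta> n w v = (\<Sum>j<n. mulA \<theta> (w j) (v j))"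

definition single :: "nat \<Rightarrow> coeffs \<Rightarrow> nat \<Rightarrow> coeffs" where
  "single j a = (\<lambda>i. if i = j then a else 0)"

lemma vmul_freeA [simp]: "v \<in> freeA n \<Longrightarrow> a \<in> Ath \<Longrightarrow> vmul \<theta> v a \<in> freeA n"
  by (simp add: vmul_def freeA_iff)

lemma vdelta_freeA [simp]: "v \<in> freeA n \<Longrightarrow> vdelta \<tau> v \<in> freeA n"
  by (simp add: vdelta_def freeA_iff)

lemma single_freeA [simp]: "j < n \<Longrightarrow> a \<in> Ath \<Longrightarrow> single j a \<in> freeA n"
  by (auto simp: single_def freeA_iff)

lemma vmul_add_left: "v \<in> freeA n \<Longrightarrow> w \<in> freeA n \<Longrightarrow> a \<in> Ath \<Longrightarrow> vmul \<theta> (v + w) a = vmul \<theta> v a + vmul \<theta> w a"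
  by (simp add: vmul_def fun_eq_iff[where 'a = nat] mulA_add_left freeA_iff)

lemma vmul_diff_left:
  assumes "v \<in> freeA n" "w \<in> freeA n" "a \<in> Ath"
  shows "vmul \<theta> (v - w) a = vmul \<theta> v a - vmul \<theta> w a"
  using vmul_add_left[of "v - w" n w a \<theta>] assms by (simp add: algebra_simps)

lemma vdelta_add: "vdelta \<tau> (v + w) = vdelta \<tau> v + vdelta \<tau> w"
  and vdelta_0 [simp]: "vdelta \<tau> 0 = 0"
  by (simp_all add: vdelta_def fun_eq_iff[where 'a = nat] deltaA_add)

lemma vdelta_vmul:
  "v \<in> freeA n \<Longrightarrow> a \<in> Ath \<Longrightarrow> vdelta \<tau> (vmul \<theta> v a) = vmul \<theta> (vdelta \<tau> v) a + vmul \<theta> v (deltaA \<tau> a)"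
  by (simp add: vdelta_def vmul_def fun_eq_iff[where 'a = nat] deltaA_mulA freeA_iff)

lemma single_vmul: "single j a = vmul \<theta> (single j (cstA 1)) a"
  by (auto simp: single_def vmul_def mulA_cstA)

text \<open>Only additivity is assumed, because besides module maps the lemma is applied to a
  connection, which is not linear over the algebra.\<close>

lemma additive_freeA_expand:
  fixes T :: "(nat \<Rightarrow> coeffs) \<Rightarrow> 'b::ab_group_add"
  assumes add: "\<And>v w. v \<in> freeA n \<Longrightarrow> w \<in> freeA n \<Longrightarrow> T (v + w) = T v + T w" and v: "v \<in> freeA n"
  shows "T v = (\<Sum>j<n. T (single j (v j)))"
proof -
  have "T (\<lambda>i. if i < m then v i else 0) = (\<Sum>j<m. T (single j (v j)))" if "m \<le> n" for m
    using that
  proof (induction m)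
    case 0
    have "T 0 = 0" using add[of 0 0] by simp
    then show ?case by (simp add: zero_fun_def)
  next
    case (Suc m)
    have "(\<lambda>i. if i < Suc m then v i else 0) = (\<lambda>i. if i < m then v i else 0) + single m (v m)"
      by (auto simp: fun_eq_iff single_def less_Suc_eq)
    moreover have "(\<lambda>i. if i < m then v i else 0) \<in> freeA n" using v Suc.prems by (auto simp: freeA_iff)
    moreover have "single m (v m) \<in> freeA n" using Suc.prems v by (simp add: freeA_D)
    ultimately show ?case using Suc add by simp
  qed
  from this[of n] have "T (\<lambda>i. if i < n then v i else 0) = (\<Sum>j<n. T (single j (v j)))" by simp
  moreover have "(\<lambda>i. if i < n then v i else 0) = v" using v by (auto simp: freeA_iff)
  ultimately show ?thesis by simp
qed

text \<open>Rows pass through \<open>twisted_reflect\<close>, unlike columns, so that the trace of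
  row times column becomes the plain bilinear sum over coordinates.\<close>

definition dual_flatten :: "real \<Rightarrow> nat \<Rightarrow> (nat \<Rightarrow> coeffs) \<Rightarrow> nat \<times> int \<times> int \<Rightarrow> complex" where
  "dual_flatten \<theta> n w p = (if fst p < n then twisted_reflect \<theta> (w (fst p)) (snd p) else 0)"

definition dual_columns :: "real \<Rightarrow> nat \<Rightarrow> (nat \<times> int \<times> int \<Rightarrow> complex) \<Rightarrow> nat \<Rightarrow> coeffs" where
  "dual_columns \<theta> n V i = twisted_reflect_inv \<theta> (columns n V i)"

lemma twisted_reflect_inv_0 [simp]: "twisted_reflect_inv \<theta> 0 = 0"
  by (simp add: twisted_reflect_inv_def fun_eq_iff)

lemma dual_columns_freeA: "Z2n.decays V \<Longrightarrow> dual_columns \<theta> n V \<in> freeA n"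
  using columns_freeA[of V n] by (simp add: freeA_iff dual_columns_def Ath_twisted_reflect_inv)

lemma dual_columns_flatten: "w \<in> freeA n \<Longrightarrow> dual_columns \<theta> n (dual_flatten \<theta> n w) = w"
  by (auto simp: fun_eq_iff[where 'a = nat] dual_columns_def columns_def dual_flatten_def twisted_reflect_inv_reflect freeA_iff)

lemma decays_dual_flatten:
  assumes "w \<in> freeA n"
  shows "Z2n.decays (dual_flatten \<theta> n w)"
proof -
  have "(\<lambda>i. if i < n then twisted_reflect \<theta> (w i) else 0) \<in> freeA n"
    using assms by (auto simp: freeA_iff Ath_twisted_reflect)
  moreover have "dual_flatten \<theta> n w = flatten (\<lambda>i. if i < n then twisted_reflect \<theta> (w i) else 0)"
    by (auto simp: fun_eq_iff dual_flatten_def flatten_def)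
  ultimately show ?thesis using decays_flatten by metis
qed

lemma dual_columns_add: "dual_columns \<theta> n (\<lambda>p. U p + V p) = dual_columns \<theta> n U + dual_columns \<theta> n V"
  and dual_columns_scale: "dual_columns \<theta> n (\<lambda>p. c * V p) = (\<lambda>i z. c * dual_columns \<theta> n V i z)"
  by (simp_all add: dual_columns_def fun_eq_iff columns_add columns_scale twisted_reflect_inv_def add_divide_distrib)

lemma trA_dot_has_sum:
  assumes "w \<in> freeA n" "v \<in> freeA n"
  shows "((\<lambda>p. (if fst p < n then twisted_reflect \<theta> (w (fst p)) (snd p) * v (fst p) (snd p) else 0))
    has_sum trA (dot \<theta> n w v)) UNIV"
  unfolding dot_def trA_sum
  by (rule has_sum_strip) (use assms in \<open>simp_all add: trA_mulA_has_sum freeA_iff\<close>)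

lemma trA_dot_dual_flatten: "w \<in> freeA n \<Longrightarrow> Z2n.decays V \<Longrightarrow>
    trA (dot \<theta> n w (columns n V)) = (\<Sum>\<^sub>\<infinity>p. dual_flatten \<theta> n w p * V p)"
  by (subst infsumI[OF trA_dot_has_sum[OF _ columns_freeA], symmetric])
    (auto simp: dual_flatten_def columns_def intro!: infsum_cong)

lemma trA_dot_dual_columns: "Z2n.decays V \<Longrightarrow> v \<in> freeA n \<Longrightarrow>
    trA (dot \<theta> n (dual_columns \<theta> n V) v) = (\<Sum>\<^sub>\<infinity>p. V p * flatten v p)"
  by (subst infsumI[OF trA_dot_has_sum[OF dual_columns_freeA], symmetric])
    (auto simp: dual_columns_def columns_def flatten_def twisted_reflect_reflect_inv freeA_iff not_less intro!: infsum_cong)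

lemma dot_add_left: "w \<in> freeA n \<Longrightarrow> w' \<in> freeA n \<Longrightarrow> v \<in> freeA n \<Longrightarrow>
    dot \<theta> n (w + w') v = dot \<theta> n w v + dot \<theta> n w' v"
  and dot_add_right: "w \<in> freeA n \<Longrightarrow> v' \<in> freeA n \<Longrightarrow> v \<in> freeA n \<Longrightarrow>
    dot \<theta> n w (v + v') = dot \<theta> n w v + dot \<theta> n w v'"
  by (simp_all add: dot_def mulA_add_left mulA_add_right freeA_iff sum.distrib)

lemma dot_scale_left: "dot \<theta> n (\<lambda>i z. c * w i z) v = (\<lambda>z. c * dot \<theta> n w v z)"
  by (simp add: dot_def mulA_scale_left fun_eq_iff sum_fun_apply sum_distrib_left)

lemma mulA_sum_left: "(\<And>i. i \<in> I \<Longrightarrow> f i \<in> Ath) \<Longrightarrow> a \<in> Ath \<Longrightarrow> mulA \<theta> (sum f I) a = (\<Sum>i\<in>I. mulA \<theta> (f i) a)"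
  by (induction I rule: infinite_finite_induct) (auto simp: mulA_add_left Ath_sum)

lemma dot_vmul: "w \<in> freeA n \<Longrightarrow> v \<in> freeA n \<Longrightarrow> a \<in> Ath \<Longrightarrow> dot \<theta> n w (vmul \<theta> v a) = mulA \<theta> (dot \<theta> n w v) a"
  by (simp add: dot_def vmul_def mulA_sum_left mulA_assoc freeA_iff)

lemma Ath_dot [simp]: "w \<in> freeA n \<Longrightarrow> v \<in> freeA n \<Longrightarrow> dot \<theta> n w v \<in> Ath"
  by (auto simp: dot_def freeA_iff intro!: Ath_sum)

section \<open>Holomorphic bundles\<close>

text \<open>Fixes one embedding and projection, of which \<open>fg_projective\<close> asserts only
  the existence.\<close>

locale projective_bundle =
  fixes \<theta> :: real and \<tau> :: complex and act :: "'e::ab_group_add \<Rightarrow> coeffs \<Rightarrow> 'e" and nabla :: "'e \<Rightarrow> 'e"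
    and n :: nat and \<iota> :: "'e \<Rightarrow> nat \<Rightarrow> coeffs" and \<pi> :: "(nat \<Rightarrow> coeffs) \<Rightarrow> 'e"
  assumes tau: "Im \<tau> \<noteq> 0"
    and act_add_left: "a \<in> Ath \<Longrightarrow> act (x + y) a = act x a + act y a"
    and act_add_right: "a \<in> Ath \<Longrightarrow> b \<in> Ath \<Longrightarrow> act x (a + b) = act x a + act x b"
    and act_mul: "a \<in> Ath \<Longrightarrow> b \<in> Ath \<Longrightarrow> act x (mulA \<theta> a b) = act (act x a) b"
    and act_one: "act x (cstA 1) = x"
    and nabla_add: "nabla (x + y) = nabla x + nabla y"
    and nabla_scale: "nabla (act x (cstA c)) = act (nabla x) (cstA c)"
    and nabla_act: "a \<in> Ath \<Longrightarrow> nabla (act e a) = act (nabla e) a + act e (deltaA \<tau> a)"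
    and iota_free [simp]: "\<iota> x \<in> freeA n"
    and iota_add: "\<iota> (x + y) = \<iota> x + \<iota> y"
    and iota_act: "a \<in> Ath \<Longrightarrow> \<iota> (act x a) = vmul \<theta> (\<iota> x) a"
    and pi_add: "v \<in> freeA n \<Longrightarrow> w \<in> freeA n \<Longrightarrow> \<pi> (v + w) = \<pi> v + \<pi> w"
    and pi_vmul: "v \<in> freeA n \<Longrightarrow> a \<in> Ath \<Longrightarrow> \<pi> (vmul \<theta> v a) = act (\<pi> v) a"
    and pi_iota [simp]: "\<pi> (\<iota> x) = x"
begin

section \<open>The extended connection and its matrix\<close>

lemma iota_0 [simp]: "\<iota> 0 = 0" and pi_0 [simp]: "\<pi> 0 = 0" and nabla_0 [simp]: "nabla 0 = 0"
  using iota_add[of 0 0] pi_add[of 0 0] nabla_add[of 0 0] by simp_all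

lemma pi_diff: "v \<in> freeA n \<Longrightarrow> w \<in> freeA n \<Longrightarrow> \<pi> (v - w) = \<pi> v - \<pi> w"
  using pi_add[of "v - w" w] by (simp add: algebra_simps)

definition compl :: "(nat \<Rightarrow> coeffs) \<Rightarrow> nat \<Rightarrow> coeffs" where
  "compl v = v - \<iota> (\<pi> v)"

text \<open>On the complementary summand \<open>D\<close> is the Grassmann connection.\<close>

definition D :: "(nat \<Rightarrow> coeffs) \<Rightarrow> nat \<Rightarrow> coeffs" where
  "D v = \<iota> (nabla (\<pi> v)) + compl (vdelta \<tau> (compl v))"

lemma compl_free [simp]: "v \<in> freeA n \<Longrightarrow> compl v \<in> freeA n"
  by (simp add: compl_def)

lemma pi_compl [simp]: "v \<in> freeA n \<Longrightarrow> \<pi> (compl v) = 0"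
  by (simp add: compl_def pi_diff)

lemma compl_iota [simp]: "compl (\<iota> x) = 0" and compl_0 [simp]: "compl 0 = 0"
  by (simp_all add: compl_def)

lemma compl_compl [simp]: "v \<in> freeA n \<Longrightarrow> compl (compl v) = compl v"
  using pi_compl[of v] unfolding compl_def[of "compl v"] by simp

lemma compl_add: "v \<in> freeA n \<Longrightarrow> w \<in> freeA n \<Longrightarrow> compl (v + w) = compl v + compl w"
  by (simp add: compl_def pi_add iota_add)

lemma compl_vmul: "v \<in> freeA n \<Longrightarrow> a \<in> Ath \<Longrightarrow> compl (vmul \<theta> v a) = vmul \<theta> (compl v) a"
  by (simp add: compl_def pi_vmul iota_act vmul_diff_left[of _ n])

lemma D_free [simp]: "v \<in> freeA n \<Longrightarrow> D v \<in> freeA n"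
  by (simp add: D_def)

lemma D_add: "v \<in> freeA n \<Longrightarrow> w \<in> freeA n \<Longrightarrow> D (v + w) = D v + D w"
  by (simp add: D_def pi_add nabla_add iota_add compl_add vdelta_add)

text \<open>\<open>D\<close> has no cross terms between the summands, so \<pi> and \<iota> both
  intertwine it with \<open>nabla\<close>: \<pi> transports statements about the image, \<iota>
  those about the kernel.\<close>

lemma pi_D: "v \<in> freeA n \<Longrightarrow> \<pi> (D v) = nabla (\<pi> v)"
  by (simp add: D_def pi_add)

lemma D_iota: "D (\<iota> x) = \<iota> (nabla x)"
  by (simp add: D_def)

lemma D_vmul:
  assumes v: "v \<in> freeA n" and a: "a \<in> Ath"
  shows "D (vmul \<theta> v a) = vmul \<theta> (D v) a + vmul \<theta> v (deltaA \<tau> a)"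
proof -
  have "\<iota> (nabla (\<pi> (vmul \<theta> v a))) = vmul \<theta> (\<iota> (nabla (\<pi> v))) a + vmul \<theta> (\<iota> (\<pi> v)) (deltaA \<tau> a)"
    using v a by (simp add: pi_vmul nabla_act iota_add iota_act)
  moreover have "compl (vdelta \<tau> (compl (vmul \<theta> v a)))
      = vmul \<theta> (compl (vdelta \<tau> (compl v))) a + vmul \<theta> (compl v) (deltaA \<tau> a)"
    using v a by (simp add: compl_vmul vdelta_vmul[of _ n] compl_add)
  \<comment> \<open>The Leibniz terms of the two summands recombine because \<open>v\<close> is the
    sum of its two components.\<close>
  moreover have "vmul \<theta> v (deltaA \<tau> a) = vmul \<theta> (\<iota> (\<pi> v)) (deltaA \<tau> a) + vmul \<theta> (compl v) (deltaA \<tau> a)"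
    using vmul_add_left[of "\<iota> (\<pi> v)" n "compl v" "deltaA \<tau> a" \<theta>] v a by (simp add: compl_def)
  moreover have "vmul \<theta> (D v) a = vmul \<theta> (\<iota> (nabla (\<pi> v))) a + vmul \<theta> (compl (vdelta \<tau> (compl v))) a"
    unfolding D_def by (rule vmul_add_left[of _ n]) (use v a in simp_all)
  ultimately show ?thesis by (simp add: D_def[of "vmul \<theta> v a"] algebra_simps)
qed

definition conn_matrix :: "nat \<Rightarrow> nat \<Rightarrow> coeffs" where
  "conn_matrix i j = (if j < n then D (single j (cstA 1)) i else 0)"

lemma Ath_conn_matrix: "conn_matrix i j \<in> Ath"
  using freeA_D(1)[OF D_free[OF single_freeA[of j n "cstA 1"]]] by (simp add: conn_matrix_def)

text \<open>By the Leibniz rule \<open>D - vdelta\<close> commutes with right multiplication, hence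
  is left multiplication by the matrix whose columns are the values of \<open>D\<close> on the
  standard basis.\<close>

lemma D_expand:
  assumes v: "v \<in> freeA n"
  shows "D v i = deltaA \<tau> (v i) + (\<Sum>j<n. mulA \<theta> (conn_matrix i j) (v j))"
proof -
  have "D v i = (\<Sum>j<n. D (single j (v j)) i)"
    by (rule additive_freeA_expand[OF _ v, of "\<lambda>v. D v i"]) (simp add: D_add)
  also have "\<dots> = (\<Sum>j<n. mulA \<theta> (conn_matrix i j) (v j) + (if i = j then deltaA \<tau> (v j) else 0))"
  proof (intro sum.cong refl)
    fix j assume j: "j \<in> {..<n}"
    have "D (single j (v j)) = vmul \<theta> (D (single j (cstA 1))) (v j) + vmul \<theta> (single j (cstA 1)) (deltaA \<tau> (v j))"
      unfolding single_vmul[of j "v j" \<theta>] using j freeA_D(1)[OF v] by (intro D_vmul) simp_all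
    then show "D (single j (v j)) i = mulA \<theta> (conn_matrix i j) (v j) + (if i = j then deltaA \<tau> (v j) else 0)"
      using j by (simp add: vmul_def conn_matrix_def single_def mulA_cstA)
  qed
  also have "\<dots> = (if i < n then deltaA \<tau> (v i) else 0) + (\<Sum>j<n. mulA \<theta> (conn_matrix i j) (v j))"
    by (simp add: sum.distrib add.commute)
  also have "(if i < n then deltaA \<tau> (v i) else 0) = deltaA \<tau> (v i)"
    using freeA_D(2)[OF v, of i] by auto
  finally show ?thesis .
qed

text \<open>A named choice, since the sublocales need the ellipticity constant as a fixed
  term.\<close>

definition ell_const :: real where
  "ell_const = (SOME c. 0 < c \<and> finite {p. norm (delta_symbol \<tau> n p) < c * vwt p})"

lemma elliptic: "elliptic_operator vwt (delta_symbol \<tau> n) (conv_kernel \<theta> n conn_matrix) ell_const 1 (2 * pi * (norm \<tau> + 1) + 1)"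
proof -
  have "0 < ell_const \<and> finite {p. norm (delta_symbol \<tau> n p) < ell_const * vwt p}"
    unfolding ell_const_def using delta_symbol_elliptic[OF tau] by (rule someI_ex)
  then show ?thesis
    using Z2n.weighted_index_axioms tame_conv_kernel[of conn_matrix, OF Ath_conn_matrix]
    by (intro elliptic_operator.intro elliptic_operator_axioms.intro) (auto intro: norm_delta_symbol_le[simplified])
qed

sublocale L: elliptic_operator vwt "delta_symbol \<tau> n" "conv_kernel \<theta> n conn_matrix" ell_const 1 "2 * pi * (norm \<tau> + 1) + 1"
  by (rule elliptic)

sublocale Lt: elliptic_operator vwt "delta_symbol \<tau> n" "\<lambda>p q. conv_kernel \<theta> n conn_matrix q p" ell_const 1 "2 * pi * (norm \<tau> + 1) + 1"
  by (rule L.elliptic_operator_transpose)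

text \<open>True for every decaying family: the kernel does not couple the rows beyond the rank to
  the first \<open>n\<close>.\<close>

lemma columns_ell:
  assumes V: "Z2n.decays V"
  shows "columns n (L.ell V) = D (columns n V)"
proof
  fix i
  show "columns n (L.ell V) i = D (columns n V) i"
  proof (cases "i < n")
    case True
    then show ?thesis
      unfolding D_expand[OF columns_freeA[OF V]] columns_def[of n "L.ell V"]
      by (auto simp: fun_eq_iff L.ell_def app_conv_kernel[OF Ath_conn_matrix V] delta_symbol_def deltaA_conv columns_def[of n V i])
  next
    case False
    then show ?thesis using freeA_D(2)[OF D_free[OF columns_freeA[OF V]], of i] by (simp add: columns_def)
  qed
qed

lemma ell_flatten:
  assumes v: "v \<in> freeA n"
  shows "L.ell (flatten v) = flatten (D v)"
proof
  fix p :: "nat \<times> int \<times> int"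
  obtain i z where p: "p = (i, z)" by (cases p)
  show "L.ell (flatten v) p = flatten (D v) p"
  proof (cases "i < n")
    case True
    have "columns n (L.ell (flatten v)) i z = D v i z" using columns_ell[OF decays_flatten[OF v]] v by simp
    then show ?thesis using True by (simp add: p columns_def flatten_def)
  next
    case False
    then show ?thesis
      using freeA_D(2)[OF v, of i] freeA_D(2)[OF D_free[OF v], of i]
      by (simp add: L.ell_def p app_conv_kernel[OF Ath_conn_matrix decays_flatten[OF v]]) (simp add: flatten_def)
  qed
qed

section \<open>The dual module as rows\<close>

definition row_functional :: "(nat \<Rightarrow> coeffs) \<Rightarrow> 'e \<Rightarrow> coeffs" where
  "row_functional w e = dot \<theta> n w (\<iota> e)"

definition row :: "('e \<Rightarrow> coeffs) \<Rightarrow> nat \<Rightarrow> coeffs" where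
  "row f i = (if i < n then f (\<pi> (single i (cstA 1))) else 0)"

lemma dualD:
  assumes "f \<in> dual \<theta> act"
  shows "f e \<in> Ath" "f (x + y) = f x + f y" "a \<in> Ath \<Longrightarrow> f (act x a) = mulA \<theta> (f x) a"
  using assms by (auto simp: dual_def addA_eq)

lemma dualI: "(\<And>e. f e \<in> Ath) \<Longrightarrow> (\<And>x y. f (x + y) = f x + f y) \<Longrightarrow>
    (\<And>x a. a \<in> Ath \<Longrightarrow> f (act x a) = mulA \<theta> (f x) a) \<Longrightarrow> f \<in> dual \<theta> act"
  by (auto simp: dual_def addA_eq)

lemma row_functional_dual: "w \<in> freeA n \<Longrightarrow> row_functional w \<in> dual \<theta> act"
  by (rule dualI) (simp_all add: row_functional_def iota_add iota_act dot_add_right dot_vmul)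

lemma row_free: "f \<in> dual \<theta> act \<Longrightarrow> row f \<in> freeA n"
  by (simp add: freeA_iff row_def dualD)

lemma dual_pi:
  assumes f: "f \<in> dual \<theta> act" and v: "v \<in> freeA n"
  shows "f (\<pi> v) = dot \<theta> n (row f) v"
proof -
  have "f (\<pi> v) = (\<Sum>j<n. f (\<pi> (single j (v j))))"
    by (rule additive_freeA_expand[of n "\<lambda>v. f (\<pi> v)", OF _ v]) (simp add: pi_add dualD(2)[OF f])
  also have "\<dots> = dot \<theta> n (row f) v"
    unfolding dot_def
  proof (intro sum.cong refl)
    fix j assume j: "j \<in> {..<n}"
    have "f (\<pi> (single j (v j))) = f (act (\<pi> (single j (cstA 1))) (v j))"
      unfolding single_vmul[of j "v j" \<theta>] using j freeA_D(1)[OF v] by (subst pi_vmul) simp_all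
    then show "f (\<pi> (single j (v j))) = mulA \<theta> (row f j) (v j)"
      using j v dualD[OF f] by (simp add: row_def freeA_iff)
  qed
  finally show ?thesis .
qed

lemma row_functional_row: "f \<in> dual \<theta> act \<Longrightarrow> row_functional (row f) = f"
  using dual_pi[of f "\<iota> _"] by (auto simp: row_functional_def fun_eq_iff)

lemma nabla_dual_eq: "nabla_dual \<tau> nabla f e = deltaA \<tau> (f e) - f (nabla e)"
  by (simp add: nabla_dual_def fun_eq_iff)

lemma nabla_dual_dual:
  assumes f: "f \<in> dual \<theta> act"
  shows "nabla_dual \<tau> nabla f \<in> dual \<theta> act"
proof (rule dualI)
  fix x a assume a: "a \<in> Ath"
  have "mulA \<theta> (deltaA \<tau> (f x) - f (nabla x)) a + mulA \<theta> (f (nabla x)) a = mulA \<theta> (deltaA \<tau> (f x)) a"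
    using mulA_add_left[of "deltaA \<tau> (f x) - f (nabla x)" "f (nabla x)" a \<theta>] a dualD(1)[OF f] by simp
  then show "nabla_dual \<tau> nabla f (act x a) = mulA \<theta> (nabla_dual \<tau> nabla f x) a"
    using a by (simp add: nabla_dual_eq dualD[OF f] nabla_act deltaA_mulA algebra_simps)
qed (simp_all add: nabla_dual_eq dualD[OF f] deltaA_add nabla_add)

lemma dual_add:
  assumes f: "f \<in> dual \<theta> act" and g: "g \<in> dual \<theta> act"
  shows "f + g \<in> dual \<theta> act"
  by (rule dualI[of "f + g"]) (simp_all add: dualD[OF f] dualD[OF g] mulA_add_left)

lemma dual_scale: "f \<in> dual \<theta> act \<Longrightarrow> (\<lambda>e z. c * f e z) \<in> dual \<theta> act"
  by (rule dualI) (simp_all add: dualD Ath_scale mulA_scale_left fun_eq_iff algebra_simps)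

lemma dual_0: "0 \<in> dual \<theta> act"
  by (rule dualI) simp_all

text \<open>Replacing \<open>e\<close> by \<open>act e a\<close> upgrades the hypothesis to
  \<open>trA (mulA \<theta> (f e) a) = 0\<close> for all \<open>a\<close>, and the trace form is
  nondegenerate.\<close>

lemma dual_eqI:
  assumes f: "f \<in> dual \<theta> act" and z: "\<And>e. trA (f e) = 0"
  shows "f = 0"
proof
  fix e
  have "f e = 0"
    using dualD(1)[OF f] by (rule trA_nondegenerate_left[where \<theta> = \<theta>]) (metis dualD(3)[OF f] z)
  then show "f e = 0 e" by simp
qed

text \<open>Among the functionals are \<open>e \<mapsto> mulA \<theta> b (\<iota> e j)\<close>, so
  each coordinate of \<open>\<iota> e\<close> is orthogonal to the whole algebra.\<close>

lemma dual_separates: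
  assumes "\<And>f. f \<in> dual \<theta> act \<Longrightarrow> trA (f e) = 0"
  shows "e = 0"
proof -
  have "\<iota> e j = 0" for j
  proof (cases "j < n")
    case True
    show ?thesis
    proof (rule trA_nondegenerate_right[where \<theta> = \<theta>])
      fix b assume b: "b \<in> Ath"
      have "dot \<theta> n (single j b) (\<iota> e) = mulA \<theta> b (\<iota> e j)"
        using True unfolding dot_def single_def by (subst sum.remove[of _ j]) auto
      then show "trA (mulA \<theta> b (\<iota> e j)) = 0"
        using assms[OF row_functional_dual[OF single_freeA[OF True b]]] by (simp add: row_functional_def)
    qed (simp add: freeA_D(1)[OF iota_free])
  next
    case False
    then show ?thesis using freeA_D(2)[OF iota_free] by simp
  qed
  then have "\<iota> e = \<iota> 0" by (simp add: fun_eq_iff[where 'a = nat])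
  then show "e = 0" by (metis pi_iota)
qed

lemma scale_vector_space: "vector_space (\<lambda>c x. act x (cstA c))"
proof -
  \<comment> \<open>The factors are swapped since scalars act from the right: scaling by
    \<open>b\<close> and then by \<open>a\<close> multiplies by \<open>cstA b\<close> first.\<close>
  have "cstA (a + b) = cstA a + cstA b" "cstA (a * b) = mulA \<theta> (cstA b) (cstA a)" for a b
    by (auto simp: mulA_cstA) (auto simp: cstA_def fun_eq_iff)
  then show ?thesis
    by unfold_locales (simp_all add: act_add_left act_add_right act_mul act_one)
qed

lemma pi_scale: "v \<in> freeA n \<Longrightarrow> \<pi> (\<lambda>i z. c * v i z) = act (\<pi> v) (cstA c)"
  using pi_vmul[of v "cstA c"] by (simp add: vmul_def mulA_cstA)

section \<open>Functionals on the bundle as traces\<close>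

context
  fixes \<psi> :: "'e \<Rightarrow> complex"
  assumes add: "\<And>x y. \<psi> (x + y) = \<psi> x + \<psi> y" and scl: "\<And>c x. \<psi> (act x (cstA c)) = c * \<psi> x"
begin

text \<open>Pulled back to families along \<open>columns n\<close> and \<pi>, the functional kills
  the image of \<open>L.ell\<close>. The family representing it is then read as a row.\<close>

lemma represent_on_cokernel:
  assumes z: "\<And>x. \<psi> (nabla x) = 0"
  shows "\<exists>f\<in>dual \<theta> act. \<forall>e. \<psi> e = trA (f e)"
proof -
  have "\<exists>W. Z2n.decays W \<and> (\<forall>V. Z2n.decays V \<longrightarrow> \<psi> (\<pi> (columns n V)) = L.ip W V)"
    by (rule L.functional_on_cokernel)
      (simp_all add: columns_add columns_scale pi_add pi_scale columns_freeA add scl columns_ell pi_D z)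
  then obtain W where W: "Z2n.decays W" "\<And>V. Z2n.decays V \<Longrightarrow> \<psi> (\<pi> (columns n V)) = L.ip W V" by blast
  have "\<psi> e = trA (row_functional (dual_columns \<theta> n W) e)" for e
    using W(2)[OF decays_flatten[OF iota_free[of e]]]
    by (simp add: row_functional_def trA_dot_dual_columns W(1) L.ip_def)
  with row_functional_dual[OF dual_columns_freeA[OF W(1)]] show ?thesis by blast
qed

lemma represent_on_kernel: "\<exists>f\<in>dual \<theta> act. \<forall>e. nabla e = 0 \<longrightarrow> \<psi> e = trA (f e)"
proof -
  have "\<exists>W. Z2n.decays W \<and> (\<forall>V. Z2n.decays V \<longrightarrow> L.ell V = (\<lambda>_. 0) \<longrightarrow> \<psi> (\<pi> (columns n V)) = L.ip W V)"
    by (rule L.functional_on_kernel)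
      (simp_all add: columns_add columns_scale pi_add pi_scale columns_freeA add scl)
  then obtain W where W: "Z2n.decays W"
      "\<And>V. Z2n.decays V \<Longrightarrow> L.ell V = (\<lambda>_. 0) \<Longrightarrow> \<psi> (\<pi> (columns n V)) = L.ip W V" by blast
  have "\<psi> e = trA (row_functional (dual_columns \<theta> n W) e)" if "nabla e = 0" for e
  proof -
    have "L.ell (flatten (\<iota> e)) = (\<lambda>_. 0)"
      using that by (simp add: ell_flatten D_iota) (simp add: flatten_def fun_eq_iff)
    from W(2)[OF decays_flatten[OF iota_free[of e]] this] show ?thesis
      by (simp add: row_functional_def trA_dot_dual_columns W(1) L.ip_def)
  qed
  with row_functional_dual[OF dual_columns_freeA[OF W(1)]] show ?thesis by blast
qed

end

lemma row_functional_add: "w \<in> freeA n \<Longrightarrow> w' \<in> freeA n \<Longrightarrow> row_functional (w + w') = row_functional w + row_functional w'"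
  and row_functional_scale: "row_functional (\<lambda>i z. c * w i z) = (\<lambda>e z. c * row_functional w e z)"
  by (simp_all add: row_functional_def fun_eq_iff[where 'a = 'e] dot_add_left dot_scale_left)

text \<open>The transposed operator is minus the dual connection: both sides have the trace
  \<open>trA (f (nabla e))\<close> at every \<open>e\<close>, because the trace of
  \<open>deltaA \<tau> (f e)\<close> is zero, and traces determine elements of the dual. The sign is
  written as a scalar so that homogeneity of a functional applies to it.\<close>

lemma row_functional_transpose_ell:
  assumes U: "Z2n.decays U"
  shows "row_functional (dual_columns \<theta> n (Lt.ell U)) = (\<lambda>e z. - 1 * nabla_dual \<tau> nabla (row_functional (dual_columns \<theta> n U)) e z)"
proof -
  let ?f = "row_functional (dual_columns \<theta> n U)" and ?g = "row_functional (dual_columns \<theta> n (Lt.ell U))"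
  have f: "?f \<in> dual \<theta> act" and g: "?g \<in> dual \<theta> act"
    by (intro row_functional_dual dual_columns_freeA U Lt.decays_ell)+
  have "trA (?g e) = trA (?f (nabla e))" for e
  proof -
    have "trA (?g e) = L.ip (Lt.ell U) (flatten (\<iota> e))"
      by (simp add: row_functional_def trA_dot_dual_columns Lt.decays_ell U L.ip_def)
    also have "\<dots> = L.ip U (L.ell (flatten (\<iota> e)))"
      unfolding Lt.ell_def[abs_def] by (rule L.ip_ell[symmetric]) (simp_all add: U decays_flatten[of _ n])
    also have "\<dots> = trA (?f (nabla e))"
      by (simp add: ell_flatten D_iota row_functional_def trA_dot_dual_columns U L.ip_def)
    finally show ?thesis .
  qed
  then have "?g + nabla_dual \<tau> nabla ?f = 0"
    by (intro dual_eqI dual_add g nabla_dual_dual f) (simp add: trA_add nabla_dual_eq trA_diff)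
  then have "?g = - nabla_dual \<tau> nabla ?f" by (simp add: eq_neg_iff_add_eq_0)
  then show ?thesis by (simp add: fun_eq_iff)
qed

section \<open>Functionals on the dual bundle as traces\<close>

context
  fixes \<xi> :: "('e \<Rightarrow> coeffs) \<Rightarrow> complex"
  assumes add: "\<And>f g. f \<in> dual \<theta> act \<Longrightarrow> g \<in> dual \<theta> act \<Longrightarrow> \<xi> (f + g) = \<xi> f + \<xi> g"
    and scl: "\<And>c f. f \<in> dual \<theta> act \<Longrightarrow> \<xi> (\<lambda>e z. c * f e z) = c * \<xi> f"
begin

text \<open>Families now stand for rows and the operator is \<open>Lt.ell\<close>; the representing
  family is read as a column and projected to the bundle.\<close>

lemma represent_on_dual_cokernel:
  assumes z: "\<And>f. f \<in> dual \<theta> act \<Longrightarrow> \<xi> (nabla_dual \<tau> nabla f) = 0"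
  shows "\<exists>e. \<forall>f\<in>dual \<theta> act. \<xi> f = trA (f e)"
proof -
  have "\<exists>W. Z2n.decays W \<and> (\<forall>V. Z2n.decays V \<longrightarrow> \<xi> (row_functional (dual_columns \<theta> n V)) = Lt.ip W V)"
  proof (rule Lt.functional_on_cokernel)
    fix U assume U: "Z2n.decays U"
    show "\<xi> (row_functional (dual_columns \<theta> n (Lt.ell U))) = 0"
      unfolding row_functional_transpose_ell[OF U]
      by (subst scl) (simp_all add: z nabla_dual_dual row_functional_dual dual_columns_freeA U)
  qed (simp_all add: dual_columns_add dual_columns_scale row_functional_add row_functional_scale dual_columns_freeA row_functional_dual add scl)
  then obtain W where W: "Z2n.decays W" "\<And>V. Z2n.decays V \<Longrightarrow> \<xi> (row_functional (dual_columns \<theta> n V)) = Lt.ip W V" by blast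
  have "\<xi> f = trA (f (\<pi> (columns n W)))" if f: "f \<in> dual \<theta> act" for f
    using W(2)[OF decays_dual_flatten[OF row_free[OF f], of \<theta>]] f
    by (simp add: dual_columns_flatten row_free row_functional_row dual_pi columns_freeA W(1) trA_dot_dual_flatten Lt.ip_def mult.commute)
  then show ?thesis by blast
qed

lemma represent_on_dual_kernel:
  "\<exists>e. \<forall>f\<in>dual \<theta> act. nabla_dual \<tau> nabla f = 0 \<longrightarrow> \<xi> f = trA (f e)"
proof -
  have "\<exists>W. Z2n.decays W \<and> (\<forall>V. Z2n.decays V \<longrightarrow> Lt.ell V = (\<lambda>_. 0) \<longrightarrow> \<xi> (row_functional (dual_columns \<theta> n V)) = Lt.ip W V)"
    by (rule Lt.functional_on_kernel)
      (simp_all add: dual_columns_add dual_columns_scale row_functional_add row_functional_scale dual_columns_freeA row_functional_dual add scl)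
  then obtain W where W: "Z2n.decays W"
      "\<And>V. Z2n.decays V \<Longrightarrow> Lt.ell V = (\<lambda>_. 0) \<Longrightarrow> \<xi> (row_functional (dual_columns \<theta> n V)) = Lt.ip W V" by blast
  have "\<xi> f = trA (f (\<pi> (columns n W)))" if f: "f \<in> dual \<theta> act" and fz: "nabla_dual \<tau> nabla f = 0" for f
  proof -
    let ?U = "dual_flatten \<theta> n (row f)"
    have U: "Z2n.decays ?U" by (rule decays_dual_flatten[OF row_free[OF f]])
    have tr: "trA (f (nabla x)) = 0" for x
      using fun_cong[OF fz, of x] by (simp add: nabla_dual_eq) (metis trA_deltaA)
    \<comment> \<open>Each coordinate is tested against a unit vector and the operator moved across,
      where it becomes \<open>nabla\<close>; the result is a trace \<open>trA (f (nabla x))\<close>,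
      which vanishes for horizontal \<open>f\<close>.\<close>
    have "Lt.ell ?U p = 0" for p
    proof -
      have "Lt.ell ?U p = L.ip (Lt.ell ?U) (L.unit_vec p)" by (simp add: L.ip_unit_vec)
      also have "\<dots> = L.ip ?U (L.ell (L.unit_vec p))"
        unfolding Lt.ell_def[abs_def] by (rule L.ip_ell[symmetric]) (simp_all add: U L.decays_unit_vec)
      also have "\<dots> = trA (dot \<theta> n (row f) (columns n (L.ell (L.unit_vec p))))"
        by (simp add: trA_dot_dual_flatten row_free f L.decays_ell L.decays_unit_vec L.ip_def)
      also have "\<dots> = trA (f (nabla (\<pi> (columns n (L.unit_vec p)))))"
        by (simp add: columns_ell L.decays_unit_vec dual_pi[OF f, symmetric] columns_freeA pi_D)
      finally show ?thesis by (simp add: tr)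
    qed
    then have "Lt.ell ?U = (\<lambda>_. 0)" by auto
    from W(2)[OF U this] f show ?thesis
      by (simp add: dual_columns_flatten row_free row_functional_row dual_pi columns_freeA W(1) trA_dot_dual_flatten Lt.ip_def mult.commute)
  qed
  then show ?thesis by blast
qed

end

text \<open>The dual is a set, not a type; all functions into the coefficient families form the
  ambient space in which it and its subspaces lie.\<close>

lemma function_vector_space: "vector_space (\<lambda>c (f :: 'e \<Rightarrow> coeffs) e z. c * f e z)"
  by unfold_locales (simp_all add: fun_eq_iff algebra_simps)

lemma nabla_dual_add: "nabla_dual \<tau> nabla (f + g) = nabla_dual \<tau> nabla f + nabla_dual \<tau> nabla g"
  and nabla_dual_scale: "nabla_dual \<tau> nabla (\<lambda>e z. c * f e z) = (\<lambda>e z. c * nabla_dual \<tau> nabla f e z)"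
  and nabla_dual_0: "nabla_dual \<tau> nabla 0 = 0"
  by (simp_all add: fun_eq_iff nabla_dual_def deltaA_conv algebra_simps)

lemma trA_nabla_dual: "trA (nabla_dual \<tau> nabla f e) = - trA (f (nabla e))"
  by (simp add: nabla_dual_eq trA_diff)

section \<open>Cohomology and the two perfect pairings\<close>

lemma add_dual_eq: "add_dual f g = f + g"
  by (simp add: add_dual_def addA_eq fun_eq_iff)

lemma lact_cstA: "lact \<theta> (cstA c) f = (\<lambda>e z. c * f e z)"
  by (simp add: lact_def mulA_cstA)

lemma zero_dual_eq: "zero_dual = 0"
  by (simp add: zero_dual_def zeroA_eq fun_eq_iff)

lemma H0_dual_iff: "f \<in> H0_dual \<theta> \<tau> act nabla \<longleftrightarrow> f \<in> dual \<theta> act \<and> nabla_dual \<tau> nabla f = 0"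
  by (simp add: H0_dual_def zero_dual_eq)

lemma trA_H0_dual: "f \<in> H0_dual \<theta> \<tau> act nabla \<Longrightarrow> trA (f (nabla x)) = 0"
  using trA_nabla_dual[of f x] by (simp add: H0_dual_iff)

lemma trA_dual_at_0: "f \<in> dual \<theta> act \<Longrightarrow> trA (f 0) = 0"
  using dualD(2)[of f 0 0] by (simp add: trA_def fun_eq_iff)

text \<open>The representing \<open>f\<close> is automatically horizontal: the trace of
  \<open>nabla_dual \<tau> nabla f\<close> at \<open>e\<close> is
  \<open>- \<psi> (nabla e) = 0\<close>, and \<open>dual_eqI\<close> applies.\<close>

lemma functional_on_H1:
  assumes "\<And>x y. \<psi> (x + y) = \<psi> x + \<psi> y" "\<And>c x. \<psi> (act x (cstA c)) = c * \<psi> x"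
    and z: "\<And>x. \<psi> (nabla x) = 0"
  shows "\<exists>f\<in>H0_dual \<theta> \<tau> act nabla. \<forall>e. \<psi> e = trA (f e)"
proof -
  obtain f where f: "f \<in> dual \<theta> act" "\<And>e. \<psi> e = trA (f e)"
    using represent_on_cokernel[OF assms] by blast
  have "nabla_dual \<tau> nabla f = 0"
    by (rule dual_eqI[OF nabla_dual_dual[OF f(1)]]) (simp add: trA_nabla_dual f(2)[symmetric] z)
  with f show ?thesis by (auto simp: H0_dual_iff)
qed

lemma functional_on_dual_H1:
  assumes "\<And>f g. f \<in> dual \<theta> act \<Longrightarrow> g \<in> dual \<theta> act \<Longrightarrow> \<xi> (f + g) = \<xi> f + \<xi> g"
    and "\<And>c f. f \<in> dual \<theta> act \<Longrightarrow> \<xi> (\<lambda>e z. c * f e z) = c * \<xi> f"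
    and z: "\<And>f. f \<in> dual \<theta> act \<Longrightarrow> \<xi> (nabla_dual \<tau> nabla f) = 0"
  shows "\<exists>e\<in>H0 nabla. \<forall>f\<in>dual \<theta> act. \<xi> f = trA (f e)"
proof -
  obtain e where e: "\<And>f. f \<in> dual \<theta> act \<Longrightarrow> \<xi> f = trA (f e)"
    using represent_on_dual_cokernel[OF assms] by blast
  have "nabla e = 0"
  proof (rule dual_separates)
    fix f assume f: "f \<in> dual \<theta> act"
    show "trA (f (nabla e)) = 0"
      using e[OF nabla_dual_dual[OF f]] z[OF f] by (simp add: trA_nabla_dual)
  qed
  with e show ?thesis by (auto simp: H0_def)
qed

lemma perfect_H1_H0_dual:
  "perfect_pairing UNIV (range nabla) (+) (\<lambda>c x. act x (cstA c))
     (H0_dual \<theta> \<tau> act nabla) {zero_dual} add_dual (\<lambda>c f. lact \<theta> (cstA c) f) pairing"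
  unfolding perfect_pairing_def
proof (intro conjI ballI allI impI)
  interpret E: vector_space "\<lambda>c x. act x (cstA c)" by (rule scale_vector_space)
  fix v assume 0: "\<forall>w\<in>H0_dual \<theta> \<tau> act nabla. pairing v w = 0"
  show "v \<in> range nabla"
  proof (rule ccontr)
    assume v: "v \<notin> range nabla"
    have "E.subspace (range nabla)"
      by (rule E.subspaceI) (auto simp flip: nabla_add nabla_scale intro: range_eqI[of _ _ 0])
    \<comment> \<open>A class outside the image is detected by a functional on \<open>H^1\<close>,
      and every such functional is a pairing with a horizontal \<open>f\<close>.\<close>
    from linear_functional_separate[OF scale_vector_space this v]
    obtain \<psi> where "\<And>x y. \<psi> (x + y) = \<psi> x + \<psi> y" "\<And>c x. \<psi> (act x (cstA c)) = c * \<psi> x"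
        "\<And>x. \<psi> (nabla x) = 0" "\<psi> v \<noteq> 0" by auto
    with functional_on_H1[of \<psi>] 0 show False by (auto simp: pairing_def)
  qed
next
  fix f assume "f \<in> H0_dual \<theta> \<tau> act nabla" "\<forall>v\<in>UNIV. pairing v f = 0"
  then show "f \<in> {zero_dual}" using dual_eqI[of f] by (auto simp: H0_dual_iff zero_dual_eq pairing_def)
next
  interpret F: vector_space "\<lambda>c (f :: 'e \<Rightarrow> coeffs) e z. c * f e z" by (rule function_vector_space)
  fix \<phi> assume \<phi>: "lin_functional_mod (H0_dual \<theta> \<tau> act nabla) {zero_dual} add_dual (\<lambda>c f. lact \<theta> (cstA c) f) \<phi>"
  have "F.subspace (H0_dual \<theta> \<tau> act nabla)"
    by (rule F.subspaceI)
      (auto simp: H0_dual_iff dual_add dual_scale dual_0 nabla_dual_add nabla_dual_scale nabla_dual_0 fun_eq_iff)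
  then have "\<exists>\<xi>. (\<forall>f g. \<xi> (f + g) = \<xi> f + \<xi> g) \<and> (\<forall>c f. \<xi> (\<lambda>e z. c * f e z) = c * \<xi> f)
      \<and> (\<forall>f\<in>H0_dual \<theta> \<tau> act nabla. \<xi> f = \<phi> f)"
    by (rule linear_functional_extend[OF function_vector_space])
      (use \<phi> in \<open>simp_all add: lin_functional_mod_def add_dual_eq lact_cstA\<close>)
  then obtain \<xi> where \<xi>: "\<forall>f g. \<xi> (f + g) = \<xi> f + \<xi> g" "\<forall>c f. \<xi> (\<lambda>e z. c * f e z) = c * \<xi> f"
      "\<forall>f\<in>H0_dual \<theta> \<tau> act nabla. \<xi> f = \<phi> f"
    by blast
  \<comment> \<open>Agreement is claimed on horizontal \<open>f\<close> only, and \<open>e\<close>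
    need not be horizontal: it stands for a class modulo the image of \<open>nabla\<close>.\<close>
  obtain e where "\<forall>f\<in>dual \<theta> act. nabla_dual \<tau> nabla f = 0 \<longrightarrow> \<xi> f = trA (f e)"
    using represent_on_dual_kernel[OF \<xi>(1,2)[rule_format]] by blast
  with \<xi>(3) have "\<forall>f\<in>H0_dual \<theta> \<tau> act nabla. \<phi> f = pairing e f"
    by (metis H0_dual_iff pairing_def)
  then
  show "\<exists>v\<in>UNIV. \<forall>w\<in>H0_dual \<theta> \<tau> act nabla. \<phi> w = pairing v w" by blast
next
  fix \<psi> assume "lin_functional_mod UNIV (range nabla) (+) (\<lambda>c x. act x (cstA c)) \<psi>"
  then show "\<exists>w\<in>H0_dual \<theta> \<tau> act nabla. \<forall>v\<in>UNIV. \<psi> v = pairing v w"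
    using functional_on_H1[of \<psi>] by (simp add: lin_functional_mod_def pairing_def)
qed (auto simp: pairing_def trA_H0_dual zero_dual_eq)

lemma perfect_H0_H1_dual:
  "perfect_pairing (H0 nabla) {0} (+) (\<lambda>c x. act x (cstA c))
     (dual \<theta> act) (nabla_dual \<tau> nabla ` dual \<theta> act) add_dual (\<lambda>c f. lact \<theta> (cstA c) f) pairing"
  unfolding perfect_pairing_def
proof (intro conjI ballI allI impI)
  fix v assume "v \<in> H0 nabla" "\<forall>w\<in>dual \<theta> act. pairing v w = 0"
  then show "v \<in> {0}" using dual_separates[of v] by (auto simp: pairing_def)
next
  interpret F: vector_space "\<lambda>c (f :: 'e \<Rightarrow> coeffs) e z. c * f e z" by (rule function_vector_space)
  fix f assume f: "f \<in> dual \<theta> act" and 0: "\<forall>v\<in>H0 nabla. pairing v f = 0"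
  show "f \<in> nabla_dual \<tau> nabla ` dual \<theta> act"
  proof (rule ccontr)
    assume nf: "f \<notin> nabla_dual \<tau> nabla ` dual \<theta> act"
    have "F.subspace (nabla_dual \<tau> nabla ` dual \<theta> act)"
      by (rule F.subspaceI)
        (auto simp flip: nabla_dual_add nabla_dual_scale simp: dual_add dual_scale
          intro: image_eqI[where f = "nabla_dual \<tau> nabla", OF nabla_dual_0[symmetric] dual_0])
    from linear_functional_separate[OF function_vector_space this nf]
    obtain \<xi> where \<xi>: "\<forall>f g. \<xi> (f + g) = \<xi> f + \<xi> g" "\<forall>c f. \<xi> (\<lambda>e z. c * f e z) = c * \<xi> f"
        "\<forall>g\<in>nabla_dual \<tau> nabla ` dual \<theta> act. \<xi> g = 0" "\<xi> f \<noteq> 0" by blast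
    have "\<exists>e\<in>H0 nabla. \<forall>f\<in>dual \<theta> act. \<xi> f = trA (f e)"
      by (rule functional_on_dual_H1) (use \<xi> in auto)
    with 0 f \<xi>(4) show False by (auto simp: pairing_def)
  qed
next
  fix \<phi> assume "lin_functional_mod (dual \<theta> act) (nabla_dual \<tau> nabla ` dual \<theta> act) add_dual (\<lambda>c f. lact \<theta> (cstA c) f) \<phi>"
  then show "\<exists>v\<in>H0 nabla. \<forall>w\<in>dual \<theta> act. \<phi> w = pairing v w"
    using functional_on_dual_H1[of \<phi>]
    by (simp add: lin_functional_mod_def pairing_def add_dual_eq lact_cstA)
next
  interpret E: vector_space "\<lambda>c x. act x (cstA c)" by (rule scale_vector_space)
  fix \<psi> assume \<psi>: "lin_functional_mod (H0 nabla) {0} (+) (\<lambda>c x. act x (cstA c)) \<psi>"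
  have "E.subspace (H0 nabla)"
    by (rule E.subspaceI) (auto simp: H0_def nabla_add nabla_scale)
  then have "\<exists>\<psi>'. (\<forall>x y. \<psi>' (x + y) = \<psi>' x + \<psi>' y) \<and> (\<forall>c x. \<psi>' (act x (cstA c)) = c * \<psi>' x)
      \<and> (\<forall>x\<in>H0 nabla. \<psi>' x = \<psi> x)"
    by (rule linear_functional_extend[OF scale_vector_space])
      (use \<psi> in \<open>simp_all add: lin_functional_mod_def\<close>)
  then obtain \<psi>' where \<psi>': "\<forall>x y. \<psi>' (x + y) = \<psi>' x + \<psi>' y" "\<forall>c x. \<psi>' (act x (cstA c)) = c * \<psi>' x"
      "\<forall>x\<in>H0 nabla. \<psi>' x = \<psi> x"
    by blast
  \<comment> \<open>Here \<open>f\<close> represents a class of \<open>H^1\<close> of the dual, so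
    agreement on horizontal \<open>e\<close> is all that is asked.\<close>
  obtain f where "f \<in> dual \<theta> act" "\<forall>e. nabla e = 0 \<longrightarrow> \<psi>' e = trA (f e)"
    using represent_on_kernel[OF \<psi>'(1,2)[rule_format]] by blast
  with \<psi>'(3) show "\<exists>w\<in>dual \<theta> act. \<forall>v\<in>H0 nabla. \<psi> v = pairing v w"
    unfolding H0_def pairing_def by (intro bexI[of _ f]) auto
qed (auto simp: pairing_def trA_dual_at_0 trA_nabla_dual H0_def)

end

section \<open>Choosing a presentation and conclusion\<close>

lemma projective_bundle_exists:
  fixes act :: "'e::ab_group_add \<Rightarrow> coeffs \<Rightarrow> 'e"
  assumes "Im \<tau> \<noteq> 0" "hol_bundle \<theta> \<tau> act nabla"
  shows "\<exists>n \<iota> \<pi>. projective_bundle \<theta> \<tau> act nabla n \<iota> \<pi>"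
proof -
  have eq: "(\<lambda>i. u i + v i) = u + v" "(\<lambda>i. mulA \<theta> (v i) a) = vmul \<theta> v a"
    for u v :: "nat \<Rightarrow> coeffs" and a by (simp_all add: fun_eq_iff vmul_def)
  note hol = assms(2)[unfolded hol_bundle_def right_module_def fg_projective_def addA_eq eq]
  then obtain n and \<iota> :: "'e \<Rightarrow> nat \<Rightarrow> coeffs" and \<pi> :: "(nat \<Rightarrow> coeffs) \<Rightarrow> 'e" where "\<forall>x. \<iota> x \<in> freeA n" "\<forall>x y. \<iota> (x + y) = \<iota> x + \<iota> y"
      "\<forall>x. \<forall>a\<in>Ath. \<iota> (act x a) = vmul \<theta> (\<iota> x) a"
      "\<forall>v\<in>freeA n. \<forall>w\<in>freeA n. \<pi> (v + w) = \<pi> v + \<pi> w"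
      "\<forall>v\<in>freeA n. \<forall>a\<in>Ath. \<pi> (vmul \<theta> v a) = act (\<pi> v) a" "\<forall>x. \<pi> (\<iota> x) = x"
    by (elim conjE exE) (rule that)
  with hol have "projective_bundle \<theta> \<tau> act nabla n \<iota> \<pi>"
    using assms(1) by unfold_locales simp_all
  then show ?thesis by blast
qed

theorem theorem2p10:
  fixes \<theta> :: real and \<tau> :: complex
    and act :: "'e::ab_group_add \<Rightarrow> coeffs \<Rightarrow> 'e" and nabla :: "'e \<Rightarrow> 'e"
  assumes "\<theta> \<notin> \<rat>" and "Im \<tau> \<noteq> 0"
    and "hol_bundle \<theta> \<tau> act nabla"
  shows
    \<comment> \<open>i = 0: H^1(E) (x) H^0(E^vee) -> C\<close>
    "perfect_pairing
        UNIV (range nabla) (+) (\<lambda>c x. act x (cstA c))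
        (H0_dual \<theta> \<tau> act nabla) {zero_dual} add_dual (\<lambda>c f. lact \<theta> (cstA c) f)
        pairing
     \<and>
     \<comment> \<open>i = 1: H^0(E) (x) H^1(E^vee) -> C\<close>
     perfect_pairing
        (H0 nabla) {0} (+) (\<lambda>c x. act x (cstA c))
        (dual \<theta> act) (nabla_dual \<tau> nabla ` dual \<theta> act) add_dual (\<lambda>c f. lact \<theta> (cstA c) f)
        pairing"
proof -
  obtain n \<iota> \<pi> where "projective_bundle \<theta> \<tau> act nabla n \<iota> \<pi>"
    using projective_bundle_exists[OF assms(2,3)] by blast
  then interpret projective_bundle \<theta> \<tau> act nabla n \<iota> \<pi> .
  show ?thesis using perfect_H1_H0_dual perfect_H0_H1_dual by blast
qed

end
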